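(* Let $X$ be a compact Hausdorff space and let $A$ be a Banach algebra. If $A$ has a bounded approximate diagonal, then so does $C(X,A)$.
   Context: Banach algebras are complex. $C(X,A)$ denotes the Banach algebra of all continuous functions $f: X\to A$ with pointwise algebraic operations and norm $\|f\|_\infty=\sup\{\|f(x)\|_A : x\in X\}$. For a Banach algebra $B$, $B\hat{\otimes}B$ is the Banach space projective tensor product, i.e. the completion of $B\otimes B$ in the norm $\|u\|_p = \inf\{\sum_{i=1}^n \|a_i\|\|b_i\| : u=\sum_{i=1}^n a_i\otimes b_i\}$. It is a Banach $B$-bimodule via $a\cdot(b\otimes c)=ab\otimes c$ and $(b\otimes c)\cdot a=b\otimes ca$. Let $\pi: B\hat{\otimes}B\to B$ be the product map, the bounded linear map determined by $\pi(a\otimes b)=ab$. A net $(u_\alpha)\subset B\hat{\otimes}B$ is an approximate diagonal for $B$ if $a\cdot u_\alpha-u_\alpha\cdot a\to 0$ and $\pi(u_\alpha)a\to a$ in norm for all $a\in B$. It is bounded if it is a norm bounded net. *)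

theory Defs
  imports "HOL-Analysis.Analysis" "HOL-Library.Multiset"
begin

section \<open>Complex Banach algebras\<close>

class complex_vector = real_vector +
  fixes scaleC :: "complex \<Rightarrow> 'a \<Rightarrow> 'a" (infixr \<open>*\<^sub>C\<close> 75)
  assumes scaleC_add_right: "c *\<^sub>C (x + y) = c *\<^sub>C x + c *\<^sub>C y"
    and scaleC_add_left: "(c + d) *\<^sub>C x = c *\<^sub>C x + d *\<^sub>C x"
    and scaleC_scaleC [simp]: "c *\<^sub>C d *\<^sub>C x = (c * d) *\<^sub>C x"
    and scaleC_of_real: "complex_of_real r *\<^sub>C x = r *\<^sub>R x"

lemma scaleC_one [simp]: "1 *\<^sub>C x = (x :: 'a :: complex_vector)"
  using scaleC_of_real [of 1 x] by simp

lemma scaleC_zero_left [simp]: "0 *\<^sub>C x = (0 :: 'a :: complex_vector)"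
  using scaleC_of_real [of 0 x] by simp

lemma scaleC_zero_right [simp]: "c *\<^sub>C 0 = (0 :: 'a :: complex_vector)"
  using scaleC_add_right [of c "0 :: 'a" 0] by simp

lemma scaleC_minus_one: "(- 1) *\<^sub>C x = - (x :: 'a :: complex_vector)"
  using scaleC_of_real [of "- 1" x] by simp

lemma scaleC_minus_right: "c *\<^sub>C (- x) = - (c *\<^sub>C x)"
  using scaleC_add_right [of c x "- x"] by (simp add: eq_neg_iff_add_eq_0 add.commute)

lemma scaleC_diff_right: "c *\<^sub>C (x - y) = c *\<^sub>C x - c *\<^sub>C y"
  using scaleC_add_right [of c x "- y"] by (simp add: scaleC_minus_right)

class complex_normed_vector = complex_vector + real_normed_vector +
  assumes norm_scaleC: "norm (c *\<^sub>C x) = cmod c * norm x"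

text \<open>No unit is assumed.\<close>

class complex_banach_algebra = complex_normed_vector + real_normed_algebra + banach +
  assumes mult_scaleC_left: "(c *\<^sub>C x) * y = c *\<^sub>C (x * y)"
    and mult_scaleC_right: "x * (c *\<^sub>C y) = c *\<^sub>C (x * y)"

section \<open>The Banach algebra of continuous functions\<close>

text \<open>
  On a compact space every continuous function is bounded (see \<open>bcontfun_compact\<close> below), so
  there \<^typ>\<open>'x \<Rightarrow>\<^sub>C 'a\<close> is the space $C(X,A)$ with the supremum norm. The library
  proves completeness only for metric domains.
\<close>

lemma bcontfun_compact:
  assumes "compact (UNIV :: 'x :: topological_space set)"
  shows "(bcontfun :: ('x \<Rightarrow> 'a :: metric_space) set) = {f. continuous_on UNIV f}"
  using assms by (auto simp: bcontfun_def intro: compact_imp_bounded compact_continuous_image)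

lemma norm_bcontfun_eq_SUP:
  fixes f :: "'x :: topological_space \<Rightarrow>\<^sub>C 'a :: real_normed_vector"
  shows "norm f = (SUP x. norm (f x))"
  by (simp add: norm_bcontfun_def dist_bcontfun.rep_eq zero_bcontfun.rep_eq)

instance bcontfun :: (topological_space, complete_space) complete_space
proof
  fix f :: "nat \<Rightarrow> ('a, 'b) bcontfun"
  assume "Cauchy f"
  then obtain g where "uniform_limit UNIV f g sequentially"
    using uniformly_convergent_eq_cauchy [of "\<lambda>_. True" f]
    unfolding Cauchy_def uniform_limit_sequentially_iff
    by (metis dist_fun_lt_imp_dist_val_lt)
  from uniform_limit_bcontfunE [OF this sequentially_bot]
  obtain l' where "g = apply_bcontfun l'" "(f \<longlonglongrightarrow> l')" by metis
  then show "convergent f"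
    by (intro convergentI)
qed

instantiation bcontfun :: (topological_space, complex_banach_algebra) complex_banach_algebra
begin

context includes bcontfun.lifting begin

lift_definition times_bcontfun :: "('a \<Rightarrow>\<^sub>C 'b) \<Rightarrow> ('a \<Rightarrow>\<^sub>C 'b) \<Rightarrow> 'a \<Rightarrow>\<^sub>C 'b"
  is "\<lambda>f g x. f x * g x"
proof -
  fix f g :: "'a \<Rightarrow> 'b" assume fg: "f \<in> bcontfun" "g \<in> bcontfun"
  then obtain B C where "\<And>x. norm (f x) \<le> B" "\<And>x. norm (g x) \<le> C"
    by (auto simp: bcontfun_def bounded_iff)
  then have "norm (f x * g x) \<le> B * C" for x
    by (meson mult_mono norm_ge_zero norm_mult_ineq order_trans)
  then show "(\<lambda>x. f x * g x) \<in> bcontfun"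
    using fg by (intro bcontfun_normI) (auto simp: bcontfun_def intro!: continuous_intros)
qed

lift_definition scaleC_bcontfun :: "complex \<Rightarrow> ('a \<Rightarrow>\<^sub>C 'b) \<Rightarrow> 'a \<Rightarrow>\<^sub>C 'b"
  is "\<lambda>c f x. c *\<^sub>C f x"
proof -
  fix c and f :: "'a \<Rightarrow> 'b" assume f: "f \<in> bcontfun"
  then obtain B where "\<And>x. norm (f x) \<le> B"
    by (auto simp: bcontfun_def bounded_iff)
  then have "norm (c *\<^sub>C f x) \<le> cmod c * B" for x
    by (simp add: norm_scaleC mult_left_mono)
  moreover have "bounded_linear (\<lambda>x :: 'b. c *\<^sub>C x)"
    by (intro bounded_linear_intro [where K = "cmod c"])
      (auto simp: scaleC_add_right norm_scaleC mult.commute simp flip: scaleC_of_real)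
  then have "continuous_on UNIV (\<lambda>x. c *\<^sub>C f x)"
    using f by (auto simp: bcontfun_def intro: bounded_linear.continuous_on)
  ultimately show "(\<lambda>x. c *\<^sub>C f x) \<in> bcontfun"
    by (intro bcontfun_normI)
qed

end

lemmas [simp] = times_bcontfun.rep_eq scaleC_bcontfun.rep_eq

instance
proof
  fix f g h :: "'a \<Rightarrow>\<^sub>C 'b" and c d :: complex and r :: real
  show "f * g * h = f * (g * h)" "(f + g) * h = f * h + g * h" "f * (g + h) = f * g + f * h"
    "(r *\<^sub>R f) * g = r *\<^sub>R (f * g)" "f * (r *\<^sub>R g) = r *\<^sub>R (f * g)"
    by (auto intro!: bcontfun_eqI simp: algebra_simps)
  show "c *\<^sub>C (f + g) = c *\<^sub>C f + c *\<^sub>C g" "(c + d) *\<^sub>C f = c *\<^sub>C f + d *\<^sub>C f"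
    "c *\<^sub>C d *\<^sub>C f = (c * d) *\<^sub>C f" "complex_of_real r *\<^sub>C f = r *\<^sub>R f"
    "(c *\<^sub>C f) * g = c *\<^sub>C (f * g)" "f * (c *\<^sub>C g) = c *\<^sub>C (f * g)"
    by (auto intro!: bcontfun_eqI simp: scaleC_add_right scaleC_add_left scaleC_of_real
        mult_scaleC_left mult_scaleC_right)
  show "norm (f * g) \<le> norm f * norm g"
    by (rule norm_bound)
      (auto intro!: order_trans [OF norm_mult_ineq] mult_mono norm_bounded)
  have le: "norm (c *\<^sub>C f) \<le> cmod c * norm f" for c and f :: "'a \<Rightarrow>\<^sub>C 'b"
    by (rule norm_bound) (auto simp: norm_scaleC intro!: mult_left_mono norm_bounded)
  show "norm (c *\<^sub>C f) = cmod c * norm f"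
  proof (cases "c = 0")
    case True
    then have "c *\<^sub>C f = 0" by (auto intro!: bcontfun_eqI)
    then show ?thesis using True by simp
  next
    case False
    then have "inverse c *\<^sub>C c *\<^sub>C f = f"
      by (auto intro!: bcontfun_eqI)
    then have "norm f \<le> inverse (cmod c) * norm (c *\<^sub>C f)"
      using le [of "inverse c" "c *\<^sub>C f"] by (simp add: norm_inverse)
    then have "cmod c * norm f \<le> norm (c *\<^sub>C f)"
      using False by (simp add: field_simps)
    with le [of c f] show ?thesis by simp
  qed
qed

end

section \<open>The algebraic tensor product\<close>

text \<open>
  A multiset stands for the finite formal sum of its elements; \<open>tensor_eq\<close> is the congruence
  generated by bilinearity. Scalars are absorbed into the factors.
\<close>

inductive tensor_eq ::
    "('a :: complex_vector \<times> 'b :: complex_vector) multiset \<Rightarrow> ('a \<times> 'b) multiset \<Rightarrow> bool"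
where
  refl: "tensor_eq M M"
| sym: "tensor_eq M N \<Longrightarrow> tensor_eq N M"
| trans: "tensor_eq M N \<Longrightarrow> tensor_eq N K \<Longrightarrow> tensor_eq M K"
| cong: "tensor_eq M N \<Longrightarrow> tensor_eq (M + K) (N + K)"
| add_left: "tensor_eq {#(a + a', b)#} {#(a, b), (a', b)#}"
| add_right: "tensor_eq {#(a, b + b')#} {#(a, b), (a, b')#}"
| scale: "tensor_eq {#(c *\<^sub>C a, b)#} {#(a, c *\<^sub>C b)#}"
| zero: "tensor_eq {#(0, b)#} {#}"

lemma tensor_eq_plus:
  assumes "tensor_eq M M'" "tensor_eq N N'"
  shows "tensor_eq (M + N) (M' + N')"
  using tensor_eq.cong [OF assms(1), of N] tensor_eq.cong [OF assms(2), of M']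
  by (metis add.commute tensor_eq.trans)

lemma tensor_eq_map:
  assumes "tensor_eq M N"
    and "\<And>x y. f (x + y) = f x + f y" "\<And>c x. f (c *\<^sub>C x) = c *\<^sub>C f x"
    and "\<And>x y. g (x + y) = g x + g y" "\<And>c x. g (c *\<^sub>C x) = c *\<^sub>C g x"
  shows "tensor_eq (image_mset (map_prod f g) M) (image_mset (map_prod f g) N)"
proof -
  have "f 0 = 0" using assms(2) [of 0 0] by simp
  with assms(1) show ?thesis
    by induction (auto simp: assms intro: tensor_eq.intros tensor_eq.trans)
qed

text \<open>The sum over a balanced bilinear map depends only on the class.\<close>

lemma tensor_eq_sum:
  fixes h :: "'a :: complex_vector \<Rightarrow> 'b :: complex_vector \<Rightarrow> 'c :: ab_group_add"
  assumes "tensor_eq M N"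
    and "\<And>x x' y. h (x + x') y = h x y + h x' y" "\<And>x y y'. h x (y + y') = h x y + h x y'"
    and "\<And>c x y. h (c *\<^sub>C x) y = h x (c *\<^sub>C y)"
  shows "(\<Sum>(a, b)\<in>#M. h a b) = (\<Sum>(a, b)\<in>#N. h a b)"
proof -
  have "h 0 y = 0" for y using assms(2) [of 0 0 y] by simp
  with assms(1) show ?thesis by induction (auto simp: assms)
qed

quotient_type (overloaded) ('a, 'b) alg_tensor =
  "('a :: complex_vector \<times> 'b :: complex_vector) multiset" / tensor_eq
  by (intro equivpI reflpI sympI transpI) (auto intro: tensor_eq.intros)

instantiation alg_tensor :: (complex_vector, complex_vector) complex_vector
begin

lift_definition zero_alg_tensor :: "('a, 'b) alg_tensor" is "{#}" .

lift_definition plus_alg_tensor ::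
    "('a, 'b) alg_tensor \<Rightarrow> ('a, 'b) alg_tensor \<Rightarrow> ('a, 'b) alg_tensor" is "(+)"
  by (rule tensor_eq_plus)

lift_definition scaleC_alg_tensor :: "complex \<Rightarrow> ('a, 'b) alg_tensor \<Rightarrow> ('a, 'b) alg_tensor"
  is "\<lambda>c. image_mset (map_prod (scaleC c) id)"
  by (rule tensor_eq_map) (auto simp: scaleC_add_right mult.commute)

definition uminus_alg_tensor :: "('a, 'b) alg_tensor \<Rightarrow> ('a, 'b) alg_tensor"
  where "- u = (- 1) *\<^sub>C u" for u :: "('a, 'b) alg_tensor"

definition minus_alg_tensor ::
    "('a, 'b) alg_tensor \<Rightarrow> ('a, 'b) alg_tensor \<Rightarrow> ('a, 'b) alg_tensor"
  where "u - v = u + - v" for u v :: "('a, 'b) alg_tensor"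

definition scaleR_alg_tensor :: "real \<Rightarrow> ('a, 'b) alg_tensor \<Rightarrow> ('a, 'b) alg_tensor"
  where "r *\<^sub>R u = complex_of_real r *\<^sub>C u" for u :: "('a, 'b) alg_tensor"

instance
proof
  fix u v w :: "('a, 'b) alg_tensor" and c d :: complex and r s :: real
  show assoc: "u + v + w = u + (v + w)" and comm: "u + v = v + u" and z: "0 + u = u"
    by (transfer; simp add: ac_simps tensor_eq.refl)+
  show 1: "c *\<^sub>C (u + v) = c *\<^sub>C u + c *\<^sub>C v" for c and u v :: "('a, 'b) alg_tensor"
    by transfer (simp add: tensor_eq.refl)
  show 2: "(c + d) *\<^sub>C u = c *\<^sub>C u + d *\<^sub>C u" for c d and u :: "('a, 'b) alg_tensor"
  proof transfer
    fix c d and M :: "('a \<times> 'b) multiset"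
    show "tensor_eq (image_mset (map_prod (scaleC (c + d)) id) M)
      (image_mset (map_prod (scaleC c) id) M + image_mset (map_prod (scaleC d) id) M)"
    proof (induction M)
      case (add p M)
      obtain a b where p: "p = (a, b)" by force
      show ?case
        using tensor_eq_plus [OF tensor_eq.add_left [of "c *\<^sub>C a" "d *\<^sub>C a" b] add.IH]
        by (simp add: p scaleC_add_left add_mset_commute)
    qed (simp add: tensor_eq.refl)
  qed
  show 3: "c *\<^sub>C d *\<^sub>C u = (c * d) *\<^sub>C u" for c d and u :: "('a, 'b) alg_tensor"
    by transfer (simp add: multiset.map_comp prod.map_comp comp_def id_def tensor_eq.refl)
  have 4: "1 *\<^sub>C u = u" for u :: "('a, 'b) alg_tensor"
  proof transfer
    fix M :: "('a \<times> 'b) multiset"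
    have "scaleC 1 = (id :: 'a \<Rightarrow> 'a)" by auto
    then show "tensor_eq (image_mset (map_prod (scaleC 1) id) M) M"
      by (simp add: prod.map_id0 tensor_eq.refl)
  qed
  have 5: "0 *\<^sub>C u = 0" for u :: "('a, 'b) alg_tensor"
  proof transfer
    fix M :: "('a \<times> 'b) multiset"
    show "tensor_eq (image_mset (map_prod (scaleC 0) id) M) {#}"
    proof (induction M)
      case (add p M)
      obtain a b where p: "p = (a, b)" by force
      show ?case
        using tensor_eq_plus [OF tensor_eq.zero [of b] add.IH] by (simp add: p)
    qed (simp add: tensor_eq.refl)
  qed
  show "- u + u = 0"
    using 2 [of "- 1" 1 u] by (simp add: uminus_alg_tensor_def 4 5)
  show "u - v = u + - v" by (rule minus_alg_tensor_def)
  show "complex_of_real r *\<^sub>C u = r *\<^sub>R u" by (simp add: scaleR_alg_tensor_def)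
  show "r *\<^sub>R (u + v) = r *\<^sub>R u + r *\<^sub>R v" "(r + s) *\<^sub>R u = r *\<^sub>R u + s *\<^sub>R u"
    "r *\<^sub>R s *\<^sub>R u = (r * s) *\<^sub>R u" "1 *\<^sub>R u = u"
    by (simp_all add: scaleR_alg_tensor_def 1 2 3 4)
qed

end

lift_definition tensor ::
    "'a :: complex_vector \<Rightarrow> 'b :: complex_vector \<Rightarrow> ('a, 'b) alg_tensor" (infix \<open>\<otimes>\<^sub>a\<close> 72)
  is "\<lambda>a b. {#(a, b)#}" .

lemma abs_alg_tensor_eq_sum: "abs_alg_tensor M = (\<Sum>(a, b)\<in>#M. a \<otimes>\<^sub>a b)"
proof (induction M)
  case empty
  show ?case by (simp add: zero_alg_tensor_def)
next
  case (add p M)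
  have "abs_alg_tensor (add_mset p M) = abs_alg_tensor {#p#} + abs_alg_tensor M"
    by (simp add: plus_alg_tensor.abs_eq)
  then show ?case
    using add.IH by (cases p) (simp add: tensor.abs_eq)
qed

lemma alg_tensor_cases: obtains M where "u = (\<Sum>(a, b)\<in>#M. a \<otimes>\<^sub>a b)"
  by (metis abs_alg_tensor_eq_sum Quotient_alg_tensor Quotient_abs_rep)

lemma tensor_add_left: "(a + a') \<otimes>\<^sub>a b = a \<otimes>\<^sub>a b + a' \<otimes>\<^sub>a b"
  by transfer (use tensor_eq.add_left in \<open>simp add: add_mset_commute\<close>)

lemma tensor_add_right: "a \<otimes>\<^sub>a (b + b') = a \<otimes>\<^sub>a b + a \<otimes>\<^sub>a b'"
  by transfer (use tensor_eq.add_right in \<open>simp add: add_mset_commute\<close>)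

lemma tensor_scaleC_left: "(c *\<^sub>C a) \<otimes>\<^sub>a b = c *\<^sub>C (a \<otimes>\<^sub>a b)"
  by transfer (simp add: tensor_eq.refl)

lemma tensor_scaleC_right: "a \<otimes>\<^sub>a (c *\<^sub>C b) = c *\<^sub>C (a \<otimes>\<^sub>a b)"
  by transfer (use tensor_eq.sym [OF tensor_eq.scale] in simp)

lemma alg_tensor_universal:
  fixes h :: "'a :: complex_vector \<Rightarrow> 'b :: complex_vector \<Rightarrow> 'c :: complex_vector"
  assumes "\<And>x x' y. h (x + x') y = h x y + h x' y" "\<And>x y y'. h x (y + y') = h x y + h x y'"
    and "\<And>c x y. h (c *\<^sub>C x) y = c *\<^sub>C h x y" "\<And>c x y. h x (c *\<^sub>C y) = c *\<^sub>C h x y"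
  shows "\<exists>!H. (\<forall>u v. H (u + v) = H u + H v) \<and> (\<forall>c u. H (c *\<^sub>C u) = c *\<^sub>C H u) \<and>
    (\<forall>a b. H (a \<otimes>\<^sub>a b) = h a b)"
proof -
  define H where "H u = (\<Sum>(a, b)\<in># rep_alg_tensor u. h a b)" for u
  have H_abs: "H (abs_alg_tensor M) = (\<Sum>(a, b)\<in>#M. h a b)" for M
    unfolding H_def
    by (rule tensor_eq_sum [OF Quotient_rep_abs [OF Quotient_alg_tensor tensor_eq.refl]])
      (auto simp: assms)
  have abs: "\<exists>M. u = abs_alg_tensor M" for u :: "('a, 'b) alg_tensor"
    by (metis Quotient_alg_tensor Quotient_abs_rep)
  have add: "H (u + v) = H u + H v" for u v
    using abs [of u] abs [of v] by (auto simp: plus_alg_tensor.abs_eq H_abs)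
  have hs: "(\<Sum>(a, b)\<in>#M. h (c *\<^sub>C a) b) = c *\<^sub>C (\<Sum>(a, b)\<in>#M. h a b)" for c M
    by (induction M) (auto simp: assms scaleC_add_right)
  have scale: "H (c *\<^sub>C u) = c *\<^sub>C H u" for c u
    using abs [of u] hs [of c]
    by (auto simp: scaleC_alg_tensor.abs_eq H_abs multiset.map_comp comp_def case_prod_unfold)
  have tens: "H (a \<otimes>\<^sub>a b) = h a b" for a b
    by (simp add: tensor.abs_eq H_abs)
  show ?thesis
  proof (intro ex1I [of _ H] conjI allI add scale tens ext)
    fix H' u
    assume H': "(\<forall>u v. H' (u + v) = H' u + H' v) \<and> (\<forall>c u. H' (c *\<^sub>C u) = c *\<^sub>C H' u) \<and>
      (\<forall>a b. H' (a \<otimes>\<^sub>a b) = h a b)"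
    then have z: "H' 0 = 0" using scaleC_zero_left by metis
    obtain M :: "('a \<times> 'b) multiset" where "u = (\<Sum>(a, b)\<in>#M. a \<otimes>\<^sub>a b)"
      by (rule alg_tensor_cases)
    moreover have "H' (\<Sum>(a, b)\<in>#M. a \<otimes>\<^sub>a b) = (\<Sum>(a, b)\<in>#M. h a b)" for M
      by (induction M) (auto simp: H' z)
    moreover have "H (\<Sum>(a, b)\<in>#M. a \<otimes>\<^sub>a b) = (\<Sum>(a, b)\<in>#M. h a b)" for M
      using H_abs [of M] by (simp add: abs_alg_tensor_eq_sum)
    ultimately show "H' u = H u" by simp
  qed
qed

section \<open>The projective norm\<close>

definition proj_norm :: "('a :: complex_normed_vector, 'b :: complex_normed_vector) alg_tensor \<Rightarrow> real"
  where "proj_norm u =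
    (INF M \<in> {M. u = (\<Sum>(a, b)\<in>#M. a \<otimes>\<^sub>a b)}. \<Sum>(a, b)\<in>#M. norm a * norm b)"

lemma sum_norm_nonneg: "0 \<le> (\<Sum>(a, b)\<in>#M. norm a * norm b)"
  by (induction M) auto

lemma proj_norm_le:
  assumes "u = (\<Sum>(a, b)\<in>#M. a \<otimes>\<^sub>a b)"
  shows "proj_norm u \<le> (\<Sum>(a, b)\<in>#M. norm a * norm b)"
  unfolding proj_norm_def using assms
  by (intro cINF_lower bdd_belowI2 [where m = 0] sum_norm_nonneg) auto

lemma proj_norm_greatest:
  assumes "\<And>M. u = (\<Sum>(a, b)\<in>#M. a \<otimes>\<^sub>a b) \<Longrightarrow> k \<le> (\<Sum>(a, b)\<in>#M. norm a * norm b)"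
  shows "k \<le> proj_norm u"
  unfolding proj_norm_def using assms
  by (intro cINF_greatest) (use alg_tensor_cases [of u] in auto)

lemma proj_norm_approx:
  assumes "proj_norm u < k"
  obtains M where "u = (\<Sum>(a, b)\<in>#M. a \<otimes>\<^sub>a b)" "(\<Sum>(a, b)\<in>#M. norm a * norm b) < k"
  using assms proj_norm_greatest [of u k] by (meson not_le)

lemma proj_norm_nonneg [simp]: "0 \<le> proj_norm u"
  by (rule proj_norm_greatest) (rule sum_norm_nonneg)

lemma proj_norm_zero [simp]: "proj_norm 0 = 0"
  using proj_norm_le [of 0 "{#}"] by (intro order_antisym) simp_all

lemma proj_norm_triangle: "proj_norm (u + v) \<le> proj_norm u + proj_norm v"
proof (rule field_le_epsilon)
  fix e :: real assume "0 < e"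
  obtain M where M: "u = (\<Sum>(a, b)\<in>#M. a \<otimes>\<^sub>a b)"
      "(\<Sum>(a, b)\<in>#M. norm a * norm b) < proj_norm u + e / 2"
    using \<open>0 < e\<close> by (rule_tac proj_norm_approx [of u "proj_norm u + e / 2"]) auto
  obtain N where N: "v = (\<Sum>(a, b)\<in>#N. a \<otimes>\<^sub>a b)"
      "(\<Sum>(a, b)\<in>#N. norm a * norm b) < proj_norm v + e / 2"
    using \<open>0 < e\<close> by (rule_tac proj_norm_approx [of v "proj_norm v + e / 2"]) auto
  show "proj_norm (u + v) \<le> proj_norm u + proj_norm v + e"
    using proj_norm_le [of "u + v" "M + N"] M N by simp
qed

lemma proj_norm_bound:
  assumes "0 \<le> k"
    and "\<And>M. u = (\<Sum>(a, b)\<in>#M. a \<otimes>\<^sub>a b) \<Longrightarrow> l \<le> k * (\<Sum>(a, b)\<in>#M. norm a * norm b)"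
  shows "l \<le> k * proj_norm u"
proof (cases "k = 0")
  case True
  then show ?thesis using assms(2) alg_tensor_cases [of u] by (metis mult_zero_left)
next
  case False
  with assms(1) have "0 < k" by simp
  then have "l / k \<le> proj_norm u"
    by (intro proj_norm_greatest) (use assms(2) in \<open>auto simp: field_simps\<close>)
  with \<open>0 < k\<close> show ?thesis by (simp add: field_simps)
qed

lemma scaleC_sum_tensor: "c *\<^sub>C (\<Sum>(a, b)\<in>#M. a \<otimes>\<^sub>a b) =
    (\<Sum>(a, b)\<in># image_mset (map_prod (scaleC c) id) M. a \<otimes>\<^sub>a b)"
  by (induction M) (auto simp: scaleC_add_right tensor_scaleC_left)

lemma proj_norm_scaleC: "proj_norm (c *\<^sub>C u) = cmod c * proj_norm u"
proof -
  have le: "proj_norm (c *\<^sub>C u) \<le> cmod c * proj_norm u" for c and u :: "('a, 'b) alg_tensor"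
  proof (rule proj_norm_bound)
    fix M assume M: "u = (\<Sum>(a, b)\<in>#M. a \<otimes>\<^sub>a b)"
    have "(\<Sum>(a, b)\<in># image_mset (map_prod (scaleC c) id) M. norm a * norm b) =
        cmod c * (\<Sum>(a, b)\<in>#M. norm a * norm b)"
      by (induction M) (auto simp: norm_scaleC algebra_simps)
    then show "proj_norm (c *\<^sub>C u) \<le> cmod c * (\<Sum>(a, b)\<in>#M. norm a * norm b)"
      using proj_norm_le scaleC_sum_tensor M by metis
  qed simp
  show ?thesis
  proof (cases "c = 0")
    case False
    have "cmod c * proj_norm u = cmod c * proj_norm (inverse c *\<^sub>C c *\<^sub>C u)"
      using False by simp
    also have "\<dots> \<le> cmod c * (cmod (inverse c) * proj_norm (c *\<^sub>C u))"
      by (intro mult_left_mono le) simp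
    also have "\<dots> = proj_norm (c *\<^sub>C u)"
      using False by (simp add: norm_inverse)
    finally show ?thesis using le [of c u] by simp
  qed simp
qed

lemma proj_norm_minus [simp]: "proj_norm (- u) = proj_norm u"
  using proj_norm_scaleC [of "- 1" u] by (simp add: scaleC_minus_one)

lemma proj_norm_minus_commute: "proj_norm (u - v) = proj_norm (v - u)"
  using proj_norm_minus [of "u - v"] by simp

lemma proj_norm_triangle_sub: "proj_norm (u - w) \<le> proj_norm (u - v) + proj_norm (v - w)"
  using proj_norm_triangle [of "u - v" "v - w"] by simp

lemma proj_norm_diff_le: "\<bar>proj_norm u - proj_norm v\<bar> \<le> proj_norm (u - v)"
  using proj_norm_triangle [of "u - v" v] proj_norm_triangle [of "v - u" u]
  by (simp add: proj_norm_minus_commute)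

section \<open>Bimodule structure and product map on algebraic tensors\<close>

lift_definition alg_lact ::
    "'a :: complex_banach_algebra \<Rightarrow> ('a, 'b :: complex_vector) alg_tensor \<Rightarrow> ('a, 'b) alg_tensor"
  is "\<lambda>a. image_mset (map_prod (\<lambda>b. a * b) id)"
  by (rule tensor_eq_map) (auto simp: distrib_left mult_scaleC_right)

lift_definition alg_ract ::
    "('a :: complex_vector, 'b :: complex_banach_algebra) alg_tensor \<Rightarrow> 'b \<Rightarrow> ('a, 'b) alg_tensor"
  is "\<lambda>M a. image_mset (map_prod id (\<lambda>c. c * a)) M"
  by (rule tensor_eq_map) (auto simp: distrib_right mult_scaleC_left)

lift_definition alg_prod :: "('a :: complex_banach_algebra, 'a) alg_tensor \<Rightarrow> 'a"
  is "\<lambda>M. \<Sum>(a, b)\<in>#M. a * b"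
  by (rule tensor_eq_sum) (auto simp: distrib_left distrib_right mult_scaleC_left mult_scaleC_right)

lemma alg_lact_tensor: "alg_lact a (b \<otimes>\<^sub>a c) = (a * b) \<otimes>\<^sub>a c"
  by transfer (simp add: tensor_eq.refl)

lemma alg_ract_tensor: "alg_ract (b \<otimes>\<^sub>a c) a = b \<otimes>\<^sub>a (c * a)"
  by transfer (simp add: tensor_eq.refl)

lemma alg_prod_tensor: "alg_prod (a \<otimes>\<^sub>a b) = a * b"
  by transfer simp

lemma alg_lact_add: "alg_lact a (u + v) = alg_lact a u + alg_lact a v"
  by transfer (simp add: tensor_eq.refl)

lemma alg_ract_add: "alg_ract (u + v) a = alg_ract u a + alg_ract v a"
  by transfer (simp add: tensor_eq.refl)

lemma alg_prod_add: "alg_prod (u + v) = alg_prod u + alg_prod v"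
  by transfer simp

lemma alg_lact_zero [simp]: "alg_lact a 0 = 0"
  using alg_lact_add [of a 0 0] by simp

lemma alg_ract_zero [simp]: "alg_ract 0 a = 0"
  using alg_ract_add [of 0 0 a] by simp

lemma alg_prod_zero [simp]: "alg_prod 0 = 0"
  using alg_prod_add [of 0 0] by simp

lemma alg_lact_scaleC: "alg_lact a (c *\<^sub>C u) = c *\<^sub>C alg_lact a u"
proof -
  obtain M where "u = (\<Sum>(a, b)\<in>#M. a \<otimes>\<^sub>a b)" by (rule alg_tensor_cases)
  moreover have "alg_lact a (c *\<^sub>C (\<Sum>(a, b)\<in>#M. a \<otimes>\<^sub>a b)) =
      c *\<^sub>C alg_lact a (\<Sum>(a, b)\<in>#M. a \<otimes>\<^sub>a b)"
    by (induction M) (auto simp: scaleC_add_right alg_lact_add alg_lact_tensor mult_scaleC_right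
        simp flip: tensor_scaleC_left)
  ultimately show ?thesis by simp
qed

lemma alg_ract_scaleC: "alg_ract (c *\<^sub>C u) a = c *\<^sub>C alg_ract u a"
proof -
  obtain M where "u = (\<Sum>(a, b)\<in>#M. a \<otimes>\<^sub>a b)" by (rule alg_tensor_cases)
  moreover have "alg_ract (c *\<^sub>C (\<Sum>(a, b)\<in>#M. a \<otimes>\<^sub>a b)) a =
      c *\<^sub>C alg_ract (\<Sum>(a, b)\<in>#M. a \<otimes>\<^sub>a b) a"
    by (induction M) (auto simp: scaleC_add_right alg_ract_add alg_ract_tensor mult_scaleC_left
        simp flip: tensor_scaleC_left)
  ultimately show ?thesis by simp
qed

lemma alg_prod_scaleC: "alg_prod (c *\<^sub>C u) = c *\<^sub>C alg_prod u"
proof -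
  obtain M where "u = (\<Sum>(a, b)\<in>#M. a \<otimes>\<^sub>a b)" by (rule alg_tensor_cases)
  moreover have "alg_prod (c *\<^sub>C (\<Sum>(a, b)\<in>#M. a \<otimes>\<^sub>a b)) =
      c *\<^sub>C alg_prod (\<Sum>(a, b)\<in>#M. a \<otimes>\<^sub>a b)"
    by (induction M) (auto simp: scaleC_add_right alg_prod_add alg_prod_tensor mult_scaleC_left
        simp flip: tensor_scaleC_left)
  ultimately show ?thesis by simp
qed

lemma alg_lact_diff: "alg_lact a (u - v) = alg_lact a u - alg_lact a v"
  using alg_lact_add [of a "u - v" v] by simp

lemma alg_ract_diff: "alg_ract (u - v) a = alg_ract u a - alg_ract v a"
  using alg_ract_add [of "u - v" v a] by simp

lemma alg_prod_diff: "alg_prod (u - v) = alg_prod u - alg_prod v"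
  using alg_prod_add [of "u - v" v] by simp

lemma proj_norm_alg_lact: "proj_norm (alg_lact a u) \<le> norm a * proj_norm u"
proof (rule proj_norm_bound)
  fix M assume M: "u = (\<Sum>(a, b)\<in>#M. a \<otimes>\<^sub>a b)"
  let ?N = "image_mset (map_prod (\<lambda>b. a * b) id) M"
  have "alg_lact a (\<Sum>(a, b)\<in>#M. a \<otimes>\<^sub>a b) = (\<Sum>(a, b)\<in>#?N. a \<otimes>\<^sub>a b)"
    by (induction M) (auto simp: alg_lact_add alg_lact_tensor)
  then have "proj_norm (alg_lact a u) \<le> (\<Sum>(a, b)\<in>#?N. norm a * norm b)"
    using M by (intro proj_norm_le) simp
  also have "\<dots> \<le> norm a * (\<Sum>(a, b)\<in>#M. norm a * norm b)"
  proof (induction M)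
    case (add p M)
    obtain x y where p: "p = (x, y)" by force
    have "norm (a * x) * norm y \<le> norm a * norm x * norm y"
      by (intro mult_right_mono norm_mult_ineq) simp
    with add show ?case by (simp add: p algebra_simps)
  qed simp
  finally show "proj_norm (alg_lact a u) \<le> norm a * (\<Sum>(a, b)\<in>#M. norm a * norm b)" .
qed simp

lemma proj_norm_alg_ract: "proj_norm (alg_ract u a) \<le> norm a * proj_norm u"
proof (rule proj_norm_bound)
  fix M assume M: "u = (\<Sum>(a, b)\<in>#M. a \<otimes>\<^sub>a b)"
  let ?N = "image_mset (map_prod id (\<lambda>c. c * a)) M"
  have "alg_ract (\<Sum>(a, b)\<in>#M. a \<otimes>\<^sub>a b) a = (\<Sum>(a, b)\<in>#?N. a \<otimes>\<^sub>a b)"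
    by (induction M) (auto simp: alg_ract_add alg_ract_tensor)
  then have "proj_norm (alg_ract u a) \<le> (\<Sum>(a, b)\<in>#?N. norm a * norm b)"
    using M by (intro proj_norm_le) simp
  also have "\<dots> \<le> norm a * (\<Sum>(a, b)\<in>#M. norm a * norm b)"
  proof (induction M)
    case (add p M)
    obtain x y where p: "p = (x, y)" by force
    have "norm x * norm (y * a) \<le> norm x * (norm y * norm a)"
      by (intro mult_left_mono norm_mult_ineq) simp
    with add show ?case by (simp add: p algebra_simps)
  qed simp
  finally show "proj_norm (alg_ract u a) \<le> norm a * (\<Sum>(a, b)\<in>#M. norm a * norm b)" .
qed simp

lemma alg_lact_lipschitz:
  "proj_norm (alg_lact a u - alg_lact a v) \<le> norm a * proj_norm (u - v)"
  using proj_norm_alg_lact [of a "u - v"] by (simp add: alg_lact_diff)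

lemma alg_ract_lipschitz:
  "proj_norm (alg_ract u a - alg_ract v a) \<le> norm a * proj_norm (u - v)"
  using proj_norm_alg_ract [of "u - v" a] by (simp add: alg_ract_diff)

lemma norm_alg_prod: "norm (alg_prod u) \<le> proj_norm u"
proof (rule proj_norm_greatest)
  fix M assume M: "u = (\<Sum>(a, b)\<in>#M. a \<otimes>\<^sub>a b)"
  have "norm (alg_prod (\<Sum>(a, b)\<in>#M. a \<otimes>\<^sub>a b)) \<le> (\<Sum>(a, b)\<in>#M. norm a * norm b)"
  proof (induction M)
    case (add p M)
    obtain x y where p: "p = (x, y)" by force
    have "norm (x * y + alg_prod (\<Sum>(a, b)\<in>#M. a \<otimes>\<^sub>a b)) \<le>
        norm x * norm y + (\<Sum>(a, b)\<in>#M. norm a * norm b)"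
      by (intro order_trans [OF norm_triangle_ineq] add_mono norm_mult_ineq add.IH)
    then show ?case by (simp add: p alg_prod_add alg_prod_tensor)
  qed simp
  with M show "norm (alg_prod u) \<le> (\<Sum>(a, b)\<in>#M. norm a * norm b)" by simp
qed

lifting_update alg_tensor.lifting
lifting_forget alg_tensor.lifting

section \<open>The projective tensor product\<close>

text \<open>
  The completion: Cauchy sequences of algebraic tensors modulo null sequences. Only the seminorm
  properties of \<^const>\<open>proj_norm\<close> are needed for it.
\<close>

definition proj_Cauchy ::
    "(nat \<Rightarrow> ('a :: complex_normed_vector, 'b :: complex_normed_vector) alg_tensor) \<Rightarrow> bool"
  where "proj_Cauchy U \<longleftrightarrow> (\<forall>e>0. \<exists>N. \<forall>m\<ge>N. \<forall>n\<ge>N. proj_norm (U m - U n) < e)"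

definition proj_rel ::
    "(nat \<Rightarrow> ('a :: complex_normed_vector, 'b :: complex_normed_vector) alg_tensor) \<Rightarrow>
      (nat \<Rightarrow> ('a, 'b) alg_tensor) \<Rightarrow> bool"
  where "proj_rel U V \<longleftrightarrow>
    proj_Cauchy U \<and> proj_Cauchy V \<and> (\<lambda>n. proj_norm (U n - V n)) \<longlonglongrightarrow> 0"

lemma proj_null_le:
  assumes "\<And>n. proj_norm (U n) \<le> f n" "f \<longlonglongrightarrow> 0"
  shows "(\<lambda>n. proj_norm (U n)) \<longlonglongrightarrow> 0"
  using assms by (intro tendsto_sandwich [OF _ _ tendsto_const assms(2)]) auto

lemma proj_Cauchy_const [simp]: "proj_Cauchy (\<lambda>_. u)"
  by (simp add: proj_Cauchy_def)

lemma proj_Cauchy_add: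
  assumes "proj_Cauchy U" "proj_Cauchy V"
  shows "proj_Cauchy (\<lambda>n. U n + V n)"
  unfolding proj_Cauchy_def
proof (intro allI impI)
  fix e :: real assume "0 < e"
  then obtain N1 N2 where N: "\<forall>m\<ge>N1. \<forall>n\<ge>N1. proj_norm (U m - U n) < e / 2"
      "\<forall>m\<ge>N2. \<forall>n\<ge>N2. proj_norm (V m - V n) < e / 2"
    using assms unfolding proj_Cauchy_def by (meson half_gt_zero)
  have "proj_norm (U m + V m - (U n + V n)) < e" if "m \<ge> max N1 N2" "n \<ge> max N1 N2" for m n
  proof -
    have "proj_norm (U m + V m - (U n + V n)) \<le> proj_norm (U m - U n) + proj_norm (V m - V n)"
      using proj_norm_triangle [of "U m - U n" "V m - V n"] by (simp add: algebra_simps)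
    moreover have "proj_norm (U m - U n) < e / 2" "proj_norm (V m - V n) < e / 2"
      using N that by auto
    ultimately show ?thesis by linarith
  qed
  then show "\<exists>N. \<forall>m\<ge>N. \<forall>n\<ge>N. proj_norm (U m + V m - (U n + V n)) < e"
    by blast
qed

lemma proj_Cauchy_lipschitz:
  assumes "proj_Cauchy U" and "\<And>u v. proj_norm (F u - F v) \<le> k * proj_norm (u - v)"
  shows "proj_Cauchy (\<lambda>n. F (U n))"
  unfolding proj_Cauchy_def
proof (intro allI impI)
  fix e :: real assume "0 < e"
  then have "0 < e / (\<bar>k\<bar> + 1)" by simp
  then obtain N where N: "\<forall>m\<ge>N. \<forall>n\<ge>N. proj_norm (U m - U n) < e / (\<bar>k\<bar> + 1)"
    using assms(1) unfolding proj_Cauchy_def by blast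
  have "proj_norm (F (U m) - F (U n)) < e" if "m \<ge> N" "n \<ge> N" for m n
  proof -
    have "proj_norm (F (U m) - F (U n)) \<le> k * proj_norm (U m - U n)"
      by (rule assms(2))
    also have "\<dots> \<le> (\<bar>k\<bar> + 1) * proj_norm (U m - U n)"
      by (intro mult_right_mono) auto
    also have "\<dots> < (\<bar>k\<bar> + 1) * (e / (\<bar>k\<bar> + 1))"
      using N that by (intro mult_strict_left_mono) auto
    finally show ?thesis by simp
  qed
  then show "\<exists>N. \<forall>m\<ge>N. \<forall>n\<ge>N. proj_norm (F (U m) - F (U n)) < e"
    by blast
qed

lemma proj_rel_add:
  assumes "proj_rel U U'" "proj_rel V V'"
  shows "proj_rel (\<lambda>n. U n + V n) (\<lambda>n. U' n + V' n)"
proof -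
  have "proj_norm (U n + V n - (U' n + V' n)) \<le> proj_norm (U n - U' n) + proj_norm (V n - V' n)"
    for n
    using proj_norm_triangle [of "U n - U' n" "V n - V' n"] by (simp add: algebra_simps)
  moreover have "(\<lambda>n. proj_norm (U n - U' n) + proj_norm (V n - V' n)) \<longlonglongrightarrow> 0"
    using assms tendsto_add [of _ 0 _ _ 0] unfolding proj_rel_def by fastforce
  ultimately have "(\<lambda>n. proj_norm (U n + V n - (U' n + V' n))) \<longlonglongrightarrow> 0"
    by (rule proj_null_le)
  then show ?thesis
    using assms by (simp add: proj_rel_def proj_Cauchy_add)
qed

lemma proj_rel_lipschitz:
  assumes "proj_rel U V" and lip: "\<And>u v. proj_norm (F u - F v) \<le> k * proj_norm (u - v)"
  shows "proj_rel (\<lambda>n. F (U n)) (\<lambda>n. F (V n))"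
proof -
  have "(\<lambda>n. k * proj_norm (U n - V n)) \<longlonglongrightarrow> 0"
    using assms(1) tendsto_mult_right_zero unfolding proj_rel_def by blast
  then have "(\<lambda>n. proj_norm (F (U n) - F (V n))) \<longlonglongrightarrow> 0"
    by (rule proj_null_le [OF lip])
  then show ?thesis
    using assms(1) proj_Cauchy_lipschitz [OF _ lip] unfolding proj_rel_def by blast
qed

lemma proj_Cauchy_norm: "proj_Cauchy U \<Longrightarrow> convergent (\<lambda>n. proj_norm (U n))"
  unfolding Cauchy_convergent_iff [symmetric] Cauchy_def proj_Cauchy_def dist_real_def
  by (meson le_less_trans proj_norm_diff_le)

quotient_type (overloaded) ('a, 'b) proj_tensor (infixr \<open>\<otimes>\<^sub>\<pi>\<close> 22) =
  "nat \<Rightarrow> ('a :: complex_normed_vector, 'b :: complex_normed_vector) alg_tensor"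
  / partial: proj_rel
proof (rule part_equivpI)
  show "\<exists>U :: nat \<Rightarrow> ('a, 'b) alg_tensor. proj_rel U U"
    by (rule exI [of _ "\<lambda>_. 0"]) (simp add: proj_rel_def)
  show "symp (proj_rel :: (nat \<Rightarrow> ('a, 'b) alg_tensor) \<Rightarrow> _)"
    by (auto intro!: sympI simp: proj_rel_def proj_norm_minus_commute)
  show "transp (proj_rel :: (nat \<Rightarrow> ('a, 'b) alg_tensor) \<Rightarrow> _)"
  proof (rule transpI)
    fix U V W :: "nat \<Rightarrow> ('a, 'b) alg_tensor"
    assume UV: "proj_rel U V" and VW: "proj_rel V W"
    then have "(\<lambda>n. proj_norm (U n - V n) + proj_norm (V n - W n)) \<longlonglongrightarrow> 0"
      using tendsto_add [of _ 0 _ _ 0] unfolding proj_rel_def by fastforce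
    then have "(\<lambda>n. proj_norm (U n - W n)) \<longlonglongrightarrow> 0"
      by (rule proj_null_le [OF proj_norm_triangle_sub])
    with UV VW show "proj_rel U W" unfolding proj_rel_def by blast
  qed
qed

lemma proj_rel_refl: "proj_rel U U \<longleftrightarrow> proj_Cauchy U"
  by (simp add: proj_rel_def)

instantiation proj_tensor :: (complex_normed_vector, complex_normed_vector) complex_vector
begin

lift_definition zero_proj_tensor :: "'a \<otimes>\<^sub>\<pi> 'b" is "\<lambda>_. 0"
  by (simp add: proj_rel_refl)

lift_definition plus_proj_tensor :: "('a \<otimes>\<^sub>\<pi> 'b) \<Rightarrow> ('a \<otimes>\<^sub>\<pi> 'b) \<Rightarrow> ('a \<otimes>\<^sub>\<pi> 'b)"
  is "\<lambda>U V n. U n + V n"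
  by (rule proj_rel_add)

lift_definition scaleC_proj_tensor :: "complex \<Rightarrow> ('a \<otimes>\<^sub>\<pi> 'b) \<Rightarrow> ('a \<otimes>\<^sub>\<pi> 'b)"
  is "\<lambda>c U n. c *\<^sub>C U n"
  by (rule proj_rel_lipschitz) (auto simp: proj_norm_scaleC simp flip: scaleC_diff_right)

lift_definition uminus_proj_tensor :: "('a \<otimes>\<^sub>\<pi> 'b) \<Rightarrow> ('a \<otimes>\<^sub>\<pi> 'b)"
  is "\<lambda>U n. - U n"
  by (rule proj_rel_lipschitz [where k = 1]) (auto simp: proj_norm_minus_commute)

definition minus_proj_tensor :: "('a \<otimes>\<^sub>\<pi> 'b) \<Rightarrow> ('a \<otimes>\<^sub>\<pi> 'b) \<Rightarrow> ('a \<otimes>\<^sub>\<pi> 'b)"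
  where "u - v = u + - v" for u v :: "'a \<otimes>\<^sub>\<pi> 'b"

definition scaleR_proj_tensor :: "real \<Rightarrow> ('a \<otimes>\<^sub>\<pi> 'b) \<Rightarrow> ('a \<otimes>\<^sub>\<pi> 'b)"
  where "r *\<^sub>R u = complex_of_real r *\<^sub>C u" for u :: "'a \<otimes>\<^sub>\<pi> 'b"

instance
proof
  fix u v w :: "'a \<otimes>\<^sub>\<pi> 'b" and c d :: complex and r s :: real
  show "u + v + w = u + (v + w)"
    by transfer (simp add: add.assoc proj_rel_refl proj_Cauchy_add)
  show "u + v = v + u"
    by transfer (simp add: add.commute proj_rel_refl proj_Cauchy_add)
  show "0 + u = u" by transfer simp
  show "- u + u = 0" by transfer (simp add: proj_rel_refl)
  show "u - v = u + - v" by (rule minus_proj_tensor_def)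
  have sc: "proj_Cauchy (\<lambda>n. c *\<^sub>C U n)" if "proj_Cauchy U" for c and U :: "nat \<Rightarrow> ('a, 'b) alg_tensor"
    using that
    by (rule proj_Cauchy_lipschitz) (auto simp: proj_norm_scaleC simp flip: scaleC_diff_right)
  show 1: "c *\<^sub>C (u + v) = c *\<^sub>C u + c *\<^sub>C v" for c and u v :: "'a \<otimes>\<^sub>\<pi> 'b"
    by transfer (simp add: scaleC_add_right proj_rel_refl proj_Cauchy_add sc)
  show 2: "(c + d) *\<^sub>C u = c *\<^sub>C u + d *\<^sub>C u" for c d and u :: "'a \<otimes>\<^sub>\<pi> 'b"
    by transfer (simp add: scaleC_add_left proj_rel_refl proj_Cauchy_add sc)
  show 3: "c *\<^sub>C d *\<^sub>C u = (c * d) *\<^sub>C u" for c d and u :: "'a \<otimes>\<^sub>\<pi> 'b"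
    by transfer (simp add: proj_rel_refl sc)
  have 4: "1 *\<^sub>C u = u" for u :: "'a \<otimes>\<^sub>\<pi> 'b"
    by transfer simp
  show "complex_of_real r *\<^sub>C u = r *\<^sub>R u" by (simp add: scaleR_proj_tensor_def)
  show "r *\<^sub>R (u + v) = r *\<^sub>R u + r *\<^sub>R v" "(r + s) *\<^sub>R u = r *\<^sub>R u + s *\<^sub>R u"
    "r *\<^sub>R s *\<^sub>R u = (r * s) *\<^sub>R u" "1 *\<^sub>R u = u"
    by (simp_all add: scaleR_proj_tensor_def 1 2 3 4)
qed

end

instantiation proj_tensor :: (complex_normed_vector, complex_normed_vector) complex_normed_vector
begin

lift_definition norm_proj_tensor :: "('a \<otimes>\<^sub>\<pi> 'b) \<Rightarrow> real"
  is "\<lambda>U. lim (\<lambda>n. proj_norm (U n))"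
proof -
  fix U V :: "nat \<Rightarrow> ('a, 'b) alg_tensor" assume UV: "proj_rel U V"
  then obtain l where l: "(\<lambda>n. proj_norm (U n)) \<longlonglongrightarrow> l"
    using proj_Cauchy_norm unfolding proj_rel_def convergent_def by blast
  have "(\<lambda>n. proj_norm (V n) - proj_norm (U n)) \<longlonglongrightarrow> 0"
  proof (rule Lim_null_comparison)
    show "(\<lambda>n. proj_norm (U n - V n)) \<longlonglongrightarrow> 0"
      using UV by (simp add: proj_rel_def)
    show "\<forall>\<^sub>F n in sequentially. norm (proj_norm (V n) - proj_norm (U n)) \<le> proj_norm (U n - V n)"
      using proj_norm_diff_le [of "U _" "V _"] by (simp add: abs_minus_commute)
  qed
  from tendsto_add [OF this l] have "(\<lambda>n. proj_norm (V n)) \<longlonglongrightarrow> l" by simp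
  with l show "lim (\<lambda>n. proj_norm (U n)) = lim (\<lambda>n. proj_norm (V n))"
    by (simp add: limI)
qed

definition dist_proj_tensor :: "('a \<otimes>\<^sub>\<pi> 'b) \<Rightarrow> ('a \<otimes>\<^sub>\<pi> 'b) \<Rightarrow> real"
  where "dist u v = norm (u - v)" for u v :: "'a \<otimes>\<^sub>\<pi> 'b"

definition sgn_proj_tensor :: "('a \<otimes>\<^sub>\<pi> 'b) \<Rightarrow> ('a \<otimes>\<^sub>\<pi> 'b)"
  where "sgn u = inverse (norm u) *\<^sub>R u" for u :: "'a \<otimes>\<^sub>\<pi> 'b"

definition uniformity_proj_tensor :: "(('a \<otimes>\<^sub>\<pi> 'b) \<times> ('a \<otimes>\<^sub>\<pi> 'b)) filter"
  where "uniformity_proj_tensor = (INF e\<in>{0 <..}. principal {(x, y). dist x y < e})"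

definition open_proj_tensor :: "('a \<otimes>\<^sub>\<pi> 'b) set \<Rightarrow> bool"
  where "open_proj_tensor S = (\<forall>x\<in>S. \<forall>\<^sub>F (x', y) in uniformity. x' = x \<longrightarrow> y \<in> S)"

lemma norm_proj_tensor_lim:
  assumes "proj_Cauchy U"
  shows "(\<lambda>n. proj_norm (U n)) \<longlonglongrightarrow> norm (abs_proj_tensor U)"
  using assms
  by (simp add: norm_proj_tensor.abs_eq proj_rel_refl proj_Cauchy_norm flip: convergent_LIMSEQ_iff)

lemma proj_tensor_cases:
  obtains U where "proj_Cauchy U" "u = abs_proj_tensor U"
  by (metis Quotient_proj_tensor Quotient_abs_rep Quotient_rep_reflp proj_rel_refl)

instance
proof
  fix u v :: "'a \<otimes>\<^sub>\<pi> 'b" and c :: complex and r :: real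
  show "dist u v = norm (u - v)" "sgn u = inverse (norm u) *\<^sub>R u"
    "(uniformity :: (('a \<otimes>\<^sub>\<pi> 'b) \<times> _) filter) = (INF e\<in>{0 <..}. principal {(x, y). dist x y < e})"
    "open S = (\<forall>x\<in>S. \<forall>\<^sub>F (x', y) in uniformity. x' = x \<longrightarrow> y \<in> S)" for S :: "('a \<otimes>\<^sub>\<pi> 'b) set"
    by (simp_all only: dist_proj_tensor_def sgn_proj_tensor_def uniformity_proj_tensor_def
        open_proj_tensor_def)
  obtain U where U: "proj_Cauchy U" "u = abs_proj_tensor U" by (rule proj_tensor_cases)
  obtain V where V: "proj_Cauchy V" "v = abs_proj_tensor V" by (rule proj_tensor_cases)
  show "norm u = 0 \<longleftrightarrow> u = 0"
  proof
    assume "norm u = 0"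
    then have "(\<lambda>n. proj_norm (U n - 0)) \<longlonglongrightarrow> 0"
      using norm_proj_tensor_lim [OF U(1)] U(2) by simp
    then have "proj_rel U (\<lambda>_. 0)" using U(1) by (simp add: proj_rel_def)
    then show "u = 0"
      using U(2) by (simp add: zero_proj_tensor_def Quotient_rel_abs [OF Quotient_proj_tensor])
  next
    assume "u = 0"
    then show "norm u = 0"
      using norm_proj_tensor_lim [of "\<lambda>_. 0"]
      by (simp add: zero_proj_tensor_def LIMSEQ_const_iff)
  qed
  show "norm (u + v) \<le> norm u + norm v"
  proof (rule tendsto_le [OF sequentially_bot])
    show "(\<lambda>n. proj_norm (U n) + proj_norm (V n)) \<longlonglongrightarrow> norm u + norm v"
      using U V norm_proj_tensor_lim by (auto intro!: tendsto_add)
    show "(\<lambda>n. proj_norm (U n + V n)) \<longlonglongrightarrow> norm (u + v)"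
      using norm_proj_tensor_lim [OF proj_Cauchy_add [OF U(1) V(1)]] U V
      by (simp add: plus_proj_tensor.abs_eq proj_rel_refl)
  qed (simp add: proj_norm_triangle)
  show C: "norm (c *\<^sub>C u) = cmod c * norm u" for c
  proof -
    have "proj_Cauchy (\<lambda>n. c *\<^sub>C U n)"
      using U(1)
      by (rule proj_Cauchy_lipschitz) (auto simp: proj_norm_scaleC simp flip: scaleC_diff_right)
    from norm_proj_tensor_lim [OF this]
    have "(\<lambda>n. cmod c * proj_norm (U n)) \<longlonglongrightarrow> norm (c *\<^sub>C u)"
      using U by (simp add: scaleC_proj_tensor.abs_eq proj_rel_refl proj_norm_scaleC)
    moreover have "(\<lambda>n. cmod c * proj_norm (U n)) \<longlonglongrightarrow> cmod c * norm u"
      using U norm_proj_tensor_lim by (auto intro!: tendsto_mult)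
    ultimately show ?thesis by (rule LIMSEQ_unique)
  qed
  show "norm (r *\<^sub>R u) = \<bar>r\<bar> * norm u"
    using C [of "complex_of_real r"] by (simp add: scaleC_of_real)
qed

end

lift_definition of_alg_tensor ::
    "('a :: complex_normed_vector, 'b :: complex_normed_vector) alg_tensor \<Rightarrow> 'a \<otimes>\<^sub>\<pi> 'b"
  is "\<lambda>u _. u"
  by (simp add: proj_rel_refl)

lemma of_alg_tensor_add: "of_alg_tensor (u + v) = of_alg_tensor u + of_alg_tensor v"
  by transfer (simp add: proj_rel_refl)

lemma of_alg_tensor_scaleC: "of_alg_tensor (c *\<^sub>C u) = c *\<^sub>C of_alg_tensor u"
  by transfer (simp add: proj_rel_refl)

lemma of_alg_tensor_diff: "of_alg_tensor (u - v) = of_alg_tensor u - of_alg_tensor v"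
  using of_alg_tensor_add [of "u - v" v] by simp

lemma norm_of_alg_tensor [simp]: "norm (of_alg_tensor u) = proj_norm u"
  by transfer simp

lemma of_alg_tensor_LIMSEQ:
  assumes U: "proj_Cauchy U"
  shows "(\<lambda>n. of_alg_tensor (U n)) \<longlonglongrightarrow> abs_proj_tensor U"
proof (rule LIMSEQ_I)
  fix e :: real assume "0 < e"
  then obtain N where N: "\<forall>m\<ge>N. \<forall>n\<ge>N. proj_norm (U m - U n) < e / 2"
    using U unfolding proj_Cauchy_def by (meson half_gt_zero)
  have "norm (of_alg_tensor (U m) - abs_proj_tensor U) < e" if "m \<ge> N" for m
  proof -
    have C: "proj_Cauchy (\<lambda>n. - U n)"
      using U by (rule proj_Cauchy_lipschitz [where k = 1]) (simp add: proj_norm_minus_commute)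
    have "proj_Cauchy (\<lambda>n. U m + - U n)"
      by (rule proj_Cauchy_add [OF proj_Cauchy_const C])
    moreover have "abs_proj_tensor (\<lambda>n. U m + - U n) = of_alg_tensor (U m) - abs_proj_tensor U"
      using U C by (simp add: of_alg_tensor.abs_eq minus_proj_tensor_def uminus_proj_tensor.abs_eq
          plus_proj_tensor.abs_eq proj_rel_refl)
    ultimately have "(\<lambda>n. proj_norm (U m - U n)) \<longlonglongrightarrow> norm (of_alg_tensor (U m) - abs_proj_tensor U)"
      using norm_proj_tensor_lim by fastforce
    then have "norm (of_alg_tensor (U m) - abs_proj_tensor U) \<le> e / 2"
      by (rule LIMSEQ_le_const2) (use N that in \<open>auto intro!: exI [of _ N] less_imp_le\<close>)
    with \<open>0 < e\<close> show ?thesis by linarith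
  qed
  then show "\<exists>N. \<forall>m\<ge>N. norm (of_alg_tensor (U m) - abs_proj_tensor U) < e"
    by blast
qed

lemma of_alg_tensor_dense: "closure (range of_alg_tensor) = UNIV"
proof -
  have "u \<in> closure (range of_alg_tensor)" for u :: "'a \<otimes>\<^sub>\<pi> 'b"
    by (rule proj_tensor_cases [of u]) (use of_alg_tensor_LIMSEQ in \<open>fastforce simp: closure_sequential\<close>)
  then show ?thesis by blast
qed

instance proj_tensor :: (complex_normed_vector, complex_normed_vector) banach
proof
  fix X :: "nat \<Rightarrow> 'a \<otimes>\<^sub>\<pi> 'b" assume X: "Cauchy X"
  have "\<exists>t. norm (X n - of_alg_tensor t) < inverse (real (Suc n))" for n
  proof -
    have "X n \<in> closure (range of_alg_tensor)" by (simp add: of_alg_tensor_dense)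
    then obtain t where "dist (of_alg_tensor t) (X n) < inverse (real (Suc n))"
      unfolding closure_approachable by (metis imageE inverse_positive_iff_positive of_nat_0_less_iff zero_less_Suc)
    then show ?thesis by (metis dist_norm norm_minus_commute)
  qed
  then obtain U where U: "\<And>n. norm (X n - of_alg_tensor (U n)) < inverse (real (Suc n))"
    by metis
  have lim0: "(\<lambda>n. X n - of_alg_tensor (U n)) \<longlonglongrightarrow> 0"
    by (rule Lim_null_comparison [OF _ LIMSEQ_inverse_real_of_nat])
      (use U in \<open>auto intro!: always_eventually less_imp_le simp del: of_nat_Suc\<close>)
  have "proj_Cauchy U"
    unfolding proj_Cauchy_def
  proof (intro allI impI)
    fix e :: real assume "0 < e"
    then have e3: "0 < e / 3" by simp
    obtain N1 where N1: "\<And>m n. m \<ge> N1 \<Longrightarrow> n \<ge> N1 \<Longrightarrow> norm (X m - X n) < e / 3"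
      using CauchyD [OF X e3] by blast
    obtain N2 where N2: "\<And>n. n \<ge> N2 \<Longrightarrow> norm (X n - of_alg_tensor (U n)) < e / 3"
      using LIMSEQ_D [OF lim0 e3] by auto
    have "proj_norm (U m - U n) < e" if "m \<ge> max N1 N2" "n \<ge> max N1 N2" for m n
    proof -
      have "of_alg_tensor (U m - U n) =
          (X m - X n) - (X m - of_alg_tensor (U m)) + (X n - of_alg_tensor (U n))"
        by (simp add: of_alg_tensor_diff)
      then have "proj_norm (U m - U n) = norm ((X m - X n) - (X m - of_alg_tensor (U m)) +
          (X n - of_alg_tensor (U n)))"
        by (metis norm_of_alg_tensor)
      also have "\<dots> \<le> norm ((X m - X n) - (X m - of_alg_tensor (U m))) +
          norm (X n - of_alg_tensor (U n))"
        by (rule norm_triangle_ineq)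
      also have "\<dots> \<le>
          norm (X m - X n) + norm (X m - of_alg_tensor (U m)) + norm (X n - of_alg_tensor (U n))"
        by (intro add_right_mono norm_triangle_ineq4)
      also have "\<dots> < e / 3 + e / 3 + e / 3"
        using that by (intro add_strict_mono N1 N2) auto
      finally show ?thesis by simp
    qed
    then show "\<exists>N. \<forall>m\<ge>N. \<forall>n\<ge>N. proj_norm (U m - U n) < e" by blast
  qed
  from tendsto_add [OF lim0 of_alg_tensor_LIMSEQ [OF this]]
  show "convergent X" by (auto simp: convergent_def)
qed

section \<open>Bimodule structure and product map\<close>

text \<open>The continuous extensions of the operations on algebraic tensors, applied termwise to
  representing Cauchy sequences.\<close>

lift_definition lact ::
    "'a :: complex_banach_algebra \<Rightarrow> 'a \<otimes>\<^sub>\<pi> ('b :: complex_normed_vector) \<Rightarrow> 'a \<otimes>\<^sub>\<pi> 'b"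
    (infixr \<open>\<bullet>\<^sub>l\<close> 73)
  is "\<lambda>a U n. alg_lact a (U n)"
  by (rule proj_rel_lipschitz [OF _ alg_lact_lipschitz])

lift_definition ract ::
    "('a :: complex_normed_vector) \<otimes>\<^sub>\<pi> ('b :: complex_banach_algebra) \<Rightarrow> 'b \<Rightarrow> 'a \<otimes>\<^sub>\<pi> 'b"
    (infixl \<open>\<bullet>\<^sub>r\<close> 73)
  is "\<lambda>U a n. alg_ract (U n) a"
  by (rule proj_rel_lipschitz [OF _ alg_ract_lipschitz])

lemma alg_prod_Cauchy:
  assumes "proj_Cauchy U"
  shows "Cauchy (\<lambda>n. alg_prod (U n))"
  using assms unfolding Cauchy_iff proj_Cauchy_def alg_prod_diff [symmetric]
  by (meson le_less_trans norm_alg_prod)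

lift_definition proj_prod :: "('a :: complex_banach_algebra) \<otimes>\<^sub>\<pi> 'a \<Rightarrow> 'a"
  is "\<lambda>U. lim (\<lambda>n. alg_prod (U n))"
proof -
  fix U V :: "nat \<Rightarrow> ('a, 'a) alg_tensor" assume UV: "proj_rel U V"
  then obtain l where l: "(\<lambda>n. alg_prod (U n)) \<longlonglongrightarrow> l"
    using alg_prod_Cauchy Cauchy_convergent unfolding proj_rel_def convergent_def by blast
  have "(\<lambda>n. alg_prod (V n) - alg_prod (U n)) \<longlonglongrightarrow> 0"
  proof (rule Lim_null_comparison)
    show "(\<lambda>n. proj_norm (V n - U n)) \<longlonglongrightarrow> 0"
      using UV by (simp add: proj_rel_def proj_norm_minus_commute)
  qed (simp add: norm_alg_prod flip: alg_prod_diff)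
  from tendsto_add [OF this l] have "(\<lambda>n. alg_prod (V n)) \<longlonglongrightarrow> l" by simp
  with l show "lim (\<lambda>n. alg_prod (U n)) = lim (\<lambda>n. alg_prod (V n))"
    by (simp add: limI)
qed

lemma lact_tensor: "a \<bullet>\<^sub>l of_alg_tensor (b \<otimes>\<^sub>a c) = of_alg_tensor ((a * b) \<otimes>\<^sub>a c)"
  by (simp add: of_alg_tensor.abs_eq lact.abs_eq proj_rel_refl alg_lact_tensor)

lemma ract_tensor: "of_alg_tensor (b \<otimes>\<^sub>a c) \<bullet>\<^sub>r a = of_alg_tensor (b \<otimes>\<^sub>a (c * a))"
  by (simp add: of_alg_tensor.abs_eq ract.abs_eq proj_rel_refl alg_ract_tensor)

lemma proj_prod_tensor: "proj_prod (of_alg_tensor (a \<otimes>\<^sub>a b)) = a * b"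
  by (simp add: of_alg_tensor.abs_eq proj_prod.abs_eq proj_rel_refl alg_prod_tensor)

lemma proj_prod_lim:
  assumes "proj_Cauchy U"
  shows "(\<lambda>n. alg_prod (U n)) \<longlonglongrightarrow> proj_prod (abs_proj_tensor U)"
  using alg_prod_Cauchy [OF assms] assms
  by (simp add: proj_prod.abs_eq proj_rel_refl Cauchy_convergent flip: convergent_LIMSEQ_iff)

lemma proj_Cauchy_lact: "proj_Cauchy U \<Longrightarrow> proj_Cauchy (\<lambda>n. alg_lact a (U n))"
  by (erule proj_Cauchy_lipschitz) (rule alg_lact_lipschitz)

lemma proj_Cauchy_ract: "proj_Cauchy U \<Longrightarrow> proj_Cauchy (\<lambda>n. alg_ract (U n) a)"
  by (erule proj_Cauchy_lipschitz) (rule alg_ract_lipschitz)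

lemma lact_scaleC: "a \<bullet>\<^sub>l (c *\<^sub>C u) = c *\<^sub>C (a \<bullet>\<^sub>l u)"
  by (rule proj_tensor_cases [of u])
    (simp add: lact.abs_eq scaleC_proj_tensor.abs_eq proj_rel_refl proj_Cauchy_lact
      alg_lact_scaleC proj_Cauchy_lipschitz [where F = "scaleC c" and k = "cmod c"]
      proj_norm_scaleC flip: scaleC_diff_right)

lemma ract_scaleC: "(c *\<^sub>C u) \<bullet>\<^sub>r a = c *\<^sub>C (u \<bullet>\<^sub>r a)"
  by (rule proj_tensor_cases [of u])
    (simp add: ract.abs_eq scaleC_proj_tensor.abs_eq proj_rel_refl proj_Cauchy_ract
      alg_ract_scaleC proj_Cauchy_lipschitz [where F = "scaleC c" and k = "cmod c"]
      proj_norm_scaleC flip: scaleC_diff_right)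

lemma bounded_linear_lact: "bounded_linear (\<lambda>u. a \<bullet>\<^sub>l u)"
proof (rule bounded_linear_intro [where K = "norm a"])
  fix u v :: "'a \<otimes>\<^sub>\<pi> 'b" and r :: real
  obtain U where U: "proj_Cauchy U" "u = abs_proj_tensor U" by (rule proj_tensor_cases)
  show "a \<bullet>\<^sub>l (u + v) = a \<bullet>\<^sub>l u + a \<bullet>\<^sub>l v"
    by transfer (simp add: alg_lact_add proj_rel_refl proj_Cauchy_add proj_Cauchy_lact)
  show "a \<bullet>\<^sub>l (r *\<^sub>R u) = r *\<^sub>R (a \<bullet>\<^sub>l u)"
    by (simp add: lact_scaleC flip: scaleC_of_real)
  have "(\<lambda>n. proj_norm (alg_lact a (U n))) \<longlonglongrightarrow> norm (a \<bullet>\<^sub>l u)"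
    using norm_proj_tensor_lim [OF proj_Cauchy_lact [OF U(1)]] U
    by (simp add: lact.abs_eq proj_rel_refl)
  moreover have "(\<lambda>n. proj_norm (U n) * norm a) \<longlonglongrightarrow> norm u * norm a"
    using U norm_proj_tensor_lim by (auto intro!: tendsto_mult)
  ultimately show "norm (a \<bullet>\<^sub>l u) \<le> norm u * norm a"
    by (rule LIMSEQ_le) (auto intro: order_trans [OF proj_norm_alg_lact] simp: mult.commute)
qed

lemma bounded_linear_ract: "bounded_linear (\<lambda>u :: 'b :: complex_normed_vector \<otimes>\<^sub>\<pi> 'a :: complex_banach_algebra. u \<bullet>\<^sub>r a)"
proof (rule bounded_linear_intro [where K = "norm a"])
  fix u v :: "'b \<otimes>\<^sub>\<pi> 'a" and r :: real
  obtain U where U: "proj_Cauchy U" "u = abs_proj_tensor U" by (rule proj_tensor_cases)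
  show "(u + v) \<bullet>\<^sub>r a = u \<bullet>\<^sub>r a + v \<bullet>\<^sub>r a"
    by transfer (simp add: alg_ract_add proj_rel_refl proj_Cauchy_add proj_Cauchy_ract)
  show "(r *\<^sub>R u) \<bullet>\<^sub>r a = r *\<^sub>R (u \<bullet>\<^sub>r a)"
    by (simp add: ract_scaleC flip: scaleC_of_real)
  have "(\<lambda>n. proj_norm (alg_ract (U n) a)) \<longlonglongrightarrow> norm (u \<bullet>\<^sub>r a)"
    using norm_proj_tensor_lim [OF proj_Cauchy_ract [OF U(1)]] U
    by (simp add: ract.abs_eq proj_rel_refl)
  moreover have "(\<lambda>n. proj_norm (U n) * norm a) \<longlonglongrightarrow> norm u * norm a"
    using U norm_proj_tensor_lim by (auto intro!: tendsto_mult)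
  ultimately show "norm (u \<bullet>\<^sub>r a) \<le> norm u * norm a"
    by (rule LIMSEQ_le) (auto intro: order_trans [OF proj_norm_alg_ract] simp: mult.commute)
qed

lemma proj_prod_scaleC: "proj_prod (c *\<^sub>C u) = c *\<^sub>C proj_prod u"
proof -
  obtain U where U: "proj_Cauchy U" "u = abs_proj_tensor U" by (rule proj_tensor_cases)
  have "proj_Cauchy (\<lambda>n. c *\<^sub>C U n)"
    using U(1)
    by (rule proj_Cauchy_lipschitz) (auto simp: proj_norm_scaleC simp flip: scaleC_diff_right)
  from proj_prod_lim [OF this] have "(\<lambda>n. c *\<^sub>C alg_prod (U n)) \<longlonglongrightarrow> proj_prod (c *\<^sub>C u)"
    using U by (simp add: scaleC_proj_tensor.abs_eq proj_rel_refl alg_prod_scaleC)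
  moreover have "bounded_linear (\<lambda>x :: 'a. c *\<^sub>C x)"
    by (intro bounded_linear_intro [where K = "cmod c"])
      (auto simp: scaleC_add_right norm_scaleC mult.commute simp flip: scaleC_of_real)
  then have "(\<lambda>n. c *\<^sub>C alg_prod (U n)) \<longlonglongrightarrow> c *\<^sub>C proj_prod u"
    unfolding U(2) by (rule bounded_linear.tendsto) (rule proj_prod_lim [OF U(1)])
  ultimately show ?thesis by (rule LIMSEQ_unique)
qed

lemma bounded_linear_proj_prod: "bounded_linear proj_prod"
proof (rule bounded_linear_intro [where K = 1])
  fix u v :: "'a \<otimes>\<^sub>\<pi> 'a" and r :: real
  obtain U where U: "proj_Cauchy U" "u = abs_proj_tensor U" by (rule proj_tensor_cases)
  obtain V where V: "proj_Cauchy V" "v = abs_proj_tensor V" by (rule proj_tensor_cases)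
  have "(\<lambda>n. alg_prod (U n) + alg_prod (V n)) \<longlonglongrightarrow> proj_prod (u + v)"
    using proj_prod_lim [OF proj_Cauchy_add [OF U(1) V(1)]] U V
    by (simp add: plus_proj_tensor.abs_eq proj_rel_refl alg_prod_add)
  moreover have "(\<lambda>n. alg_prod (U n) + alg_prod (V n)) \<longlonglongrightarrow> proj_prod u + proj_prod v"
    using U V proj_prod_lim by (auto intro!: tendsto_add)
  ultimately show "proj_prod (u + v) = proj_prod u + proj_prod v" by (rule LIMSEQ_unique)
  show "proj_prod (r *\<^sub>R u) = r *\<^sub>R proj_prod u"
    by (simp add: proj_prod_scaleC flip: scaleC_of_real)
  have "(\<lambda>n. norm (alg_prod (U n))) \<longlonglongrightarrow> norm (proj_prod u)"
    using proj_prod_lim U by (auto intro!: tendsto_norm)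
  moreover have "(\<lambda>n. proj_norm (U n)) \<longlonglongrightarrow> norm u * 1"
    using U norm_proj_tensor_lim by auto
  ultimately show "norm (proj_prod u) \<le> norm u * 1"
    by (rule LIMSEQ_le) (use norm_alg_prod in auto)
qed

section \<open>Approximate diagonals\<close>

text \<open>\<open>I\<close> is the index set of a net, directed by the preorder \<open>le\<close>.\<close>

definition directed :: "'i set \<Rightarrow> ('i \<Rightarrow> 'i \<Rightarrow> bool) \<Rightarrow> bool"
  where "directed I le \<longleftrightarrow> I \<noteq> {} \<and> (\<forall>i\<in>I. le i i) \<and>
    (\<forall>i\<in>I. \<forall>j\<in>I. \<forall>k\<in>I. le i j \<longrightarrow> le j k \<longrightarrow> le i k) \<and>
    (\<forall>i\<in>I. \<forall>j\<in>I. \<exists>k\<in>I. le i k \<and> le j k)"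

definition net_filter :: "'i set \<Rightarrow> ('i \<Rightarrow> 'i \<Rightarrow> bool) \<Rightarrow> 'i filter"
  where "net_filter I le = (INF i\<in>I. principal {j\<in>I. le i j})"

lemma eventually_net_filter:
  assumes "directed I le"
  shows "eventually P (net_filter I le) \<longleftrightarrow> (\<exists>i\<in>I. \<forall>j\<in>I. le i j \<longrightarrow> P j)"
proof -
  have ne: "I \<noteq> {}"
    and tr: "\<And>i j k. i \<in> I \<Longrightarrow> j \<in> I \<Longrightarrow> k \<in> I \<Longrightarrow> le i j \<Longrightarrow> le j k \<Longrightarrow> le i k"
    and up: "\<And>i j. i \<in> I \<Longrightarrow> j \<in> I \<Longrightarrow> \<exists>k\<in>I. le i k \<and> le j k"
    using assms unfolding directed_def by blast+
  have "\<exists>k\<in>I. principal {l\<in>I. le k l} \<le> inf (principal {l\<in>I. le i l}) (principal {l\<in>I. le j l})"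
    if ij: "i \<in> I" "j \<in> I" for i j
  proof -
    obtain k where k: "k \<in> I" "le i k" "le j k" using up [OF ij] by blast
    have "{l\<in>I. le k l} \<subseteq> {l\<in>I. le i l} \<inter> {l\<in>I. le j l}"
      using tr [OF ij(1) k(1) _ k(2)] tr [OF ij(2) k(1) _ k(3)] by blast
    with k(1) show ?thesis by (intro bexI [of _ k]) auto
  qed
  then show ?thesis
    unfolding net_filter_def by (subst eventually_INF_base [OF ne]) (auto simp: eventually_principal)
qed

definition approximate_diagonal ::
    "'i set \<Rightarrow> ('i \<Rightarrow> 'i \<Rightarrow> bool) \<Rightarrow> ('i \<Rightarrow> 'b \<otimes>\<^sub>\<pi> ('b :: complex_banach_algebra)) \<Rightarrow> bool"
  where "approximate_diagonal I le u \<longleftrightarrow> directed I le \<and>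
    (\<forall>a. ((\<lambda>i. a \<bullet>\<^sub>l u i - u i \<bullet>\<^sub>r a) \<longlongrightarrow> 0) (net_filter I le)) \<and>
    (\<forall>a. ((\<lambda>i. proj_prod (u i) * a) \<longlongrightarrow> a) (net_filter I le))"

definition bounded_approximate_diagonal ::
    "'i set \<Rightarrow> ('i \<Rightarrow> 'i \<Rightarrow> bool) \<Rightarrow> ('i \<Rightarrow> 'b \<otimes>\<^sub>\<pi> ('b :: complex_banach_algebra)) \<Rightarrow> bool"
  where "bounded_approximate_diagonal I le u \<longleftrightarrow> approximate_diagonal I le u \<and> bounded (u ` I)"

text \<open>
  HOL cannot quantify existentially over the type of indices. The type chosen here is large enough
  for all nets: see \<open>has_bounded_approximate_diagonalI\<close>, where the index type is arbitrary.
\<close>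

definition has_bounded_approximate_diagonal :: "'b :: complex_banach_algebra itself \<Rightarrow> bool"
  where "has_bounded_approximate_diagonal TYPE('b) \<longleftrightarrow>
    (\<exists>(I :: (('b \<otimes>\<^sub>\<pi> 'b) set \<times> ('b \<otimes>\<^sub>\<pi> 'b)) set) le (u :: _ \<Rightarrow> 'b \<otimes>\<^sub>\<pi> 'b).
      bounded_approximate_diagonal I le u)"

lemma has_bounded_approximate_diagonalI:
  fixes u :: "'i \<Rightarrow> 'b \<otimes>\<^sub>\<pi> ('b :: complex_banach_algebra)"
  assumes "bounded_approximate_diagonal I le u"
  shows "has_bounded_approximate_diagonal TYPE('b)"
proof -
  have dir: "directed I le"
    and lim: "\<And>a. ((\<lambda>i. a \<bullet>\<^sub>l u i - u i \<bullet>\<^sub>r a) \<longlongrightarrow> 0) (net_filter I le)"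
      "\<And>a. ((\<lambda>i. proj_prod (u i) * a) \<longlongrightarrow> a) (net_filter I le)"
    and bdd: "bounded (u ` I)"
    using assms by (auto simp: bounded_approximate_diagonal_def approximate_diagonal_def)
  have ne: "I \<noteq> {}" and rf: "\<And>i. i \<in> I \<Longrightarrow> le i i"
    and tr: "\<And>i j k. i \<in> I \<Longrightarrow> j \<in> I \<Longrightarrow> k \<in> I \<Longrightarrow> le i j \<Longrightarrow> le j k \<Longrightarrow> le i k"
    and up: "\<And>i j. i \<in> I \<Longrightarrow> j \<in> I \<Longrightarrow> \<exists>k\<in>I. le i k \<and> le j k"
    using dir unfolding directed_def by blast+
  define T where "T i = u ` {j\<in>I. le i j}" for i
  define J where "J = {(T i, x) |i x. i \<in> I \<and> x \<in> T i}"
  define le' where "le' p q \<longleftrightarrow> fst q \<subseteq> fst p" for p q :: "('b \<otimes>\<^sub>\<pi> 'b) set \<times> ('b \<otimes>\<^sub>\<pi> 'b)"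
  have inJ: "(T i, u i) \<in> J" if "i \<in> I" for i
    using that rf unfolding J_def T_def by blast
  have mono: "T j \<subseteq> T i" if "i \<in> I" "j \<in> I" "le i j" for i j
    using that tr unfolding T_def by blast
  have dir': "directed J le'"
    unfolding directed_def
  proof (intro conjI ballI impI)
    show "J \<noteq> {}" using inJ ne by blast
  next
    fix p q assume "p \<in> J" "q \<in> J"
    then obtain i j where ij: "i \<in> I" "j \<in> I" "fst p = T i" "fst q = T j" by (auto simp: J_def)
    then obtain k where "k \<in> I" "le i k" "le j k" using up by blast
    with ij show "\<exists>r\<in>J. le' p r \<and> le' q r"
      by (intro bexI [OF _ inJ [of k]]) (simp_all add: le'_def mono)
  qed (auto simp: le'_def)
  have tendsto: "((\<lambda>p. F (snd p)) \<longlongrightarrow> l) (net_filter J le')"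
    if F: "((\<lambda>i. F (u i)) \<longlongrightarrow> l) (net_filter I le)"
    for F :: "'b \<otimes>\<^sub>\<pi> 'b \<Rightarrow> 'c :: metric_space" and l
  proof (rule tendstoI)
    fix e :: real assume "0 < e"
    then obtain i where i: "i \<in> I" "\<forall>j\<in>I. le i j \<longrightarrow> dist (F (u j)) l < e"
      using tendstoD [OF F] unfolding eventually_net_filter [OF dir] by blast
    have "dist (F (snd p)) l < e" if "p \<in> J" "le' (T i, u i) p" for p
    proof -
      have "snd p \<in> T i" using that by (auto simp: J_def le'_def)
      with i show ?thesis by (auto simp: T_def)
    qed
    then show "\<forall>\<^sub>F p in net_filter J le'. dist (F (snd p)) l < e"
      unfolding eventually_net_filter [OF dir'] using inJ [OF i(1)] by blast
  qed
  have "snd ` J \<subseteq> u ` I" by (auto simp: J_def T_def)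
  then have "bounded_approximate_diagonal J le' snd"
    unfolding bounded_approximate_diagonal_def approximate_diagonal_def
    using dir' tendsto [OF lim(1)] tendsto [OF lim(2)] bounded_subset [OF bdd] by blast
  then show ?thesis
    unfolding has_bounded_approximate_diagonal_def by blast
qed

text \<open>
  Types are nonempty, so a compact space given by a type is nonempty; $C(\emptyset,A)$ is the zero
  algebra, for which existence of a bounded approximate diagonal is immediate.
\<close>

lemma has_bounded_approximate_diagonal_zero_algebra:
  assumes "\<And>x :: 'b :: complex_banach_algebra. x = 0"
  shows "has_bounded_approximate_diagonal TYPE('b)"
proof (rule has_bounded_approximate_diagonalI)
  have eq: "x = y" for x y :: 'b using assms by metis
  have 1: "a \<bullet>\<^sub>l 0 - 0 \<bullet>\<^sub>r a = (0 :: 'b \<otimes>\<^sub>\<pi> 'b)" for a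
    by (simp add: linear_simps(3) [OF bounded_linear_lact] linear_simps(3) [OF bounded_linear_ract])
  have 2: "((\<lambda>i. proj_prod 0 * a) \<longlongrightarrow> a) F" for a :: 'b and F :: "unit filter"
    by (rule tendsto_eq_rhs [OF tendsto_const eq])
  show "bounded_approximate_diagonal {()} (\<lambda>_ _. True) (\<lambda>_. 0 :: 'b \<otimes>\<^sub>\<pi> 'b)"
    unfolding bounded_approximate_diagonal_def approximate_diagonal_def
  proof (intro conjI allI)
    show "directed {()} (\<lambda>_ _. True)" by (simp add: directed_def)
    show "bounded ((\<lambda>_. 0 :: 'b \<otimes>\<^sub>\<pi> 'b) ` {()})" by simp
  qed (simp only: 1 tendsto_const, rule 2)
qed

end

theory Submission
  imports Defs
begin

text \<open>
  The idea is to lift an approximate diagonal of $A$ to $C(X,A)$ by averaging over a commutative,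
  hence amenable, group: the continuous functions \<open>\<theta> : X \<rightarrow> \<real>\<close> under addition, acting through the
  unimodular functions $e^{i\theta}$.

  For such $\sigma$, $\tau$ there is a linear contraction from the projective tensor square of
  $A$ to that of $C(X,A)$ with $b \otimes c \mapsto e^{i\sigma}b \otimes e^{i\tau}c$; it is
  called \<open>phase_twist \<sigma> \<tau>\<close>. Let $m$ be a member of a bounded approximate diagonal of $A$, and let
  $d$ be the average of \<open>phase_twist \<theta> (- \<theta>) m\<close> over finitely many $\theta$. Then $d$ has norm at
  most that of $m$, and since the phases cancel in products, $\pi(d)$ is the constant function
  $\pi(m)$. For $F = e^{i\rho}a$ the module operations give
  \<open>F \<bullet>\<^sub>l phase_twist \<theta> (- \<theta>) m = phase_twist (\<rho> + \<theta>) (- \<theta>) (a \<bullet>\<^sub>l m)\<close> and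
  \<open>phase_twist \<theta> (- \<theta>) m \<bullet>\<^sub>r F = phase_twist \<theta> (\<rho> - \<theta>) (m \<bullet>\<^sub>r a)\<close>. With
  \<open>P \<theta> = phase_twist \<theta> (\<rho> - \<theta>) (a \<bullet>\<^sub>l m)\<close> the first is \<open>P (\<rho> + \<theta>)\<close>, and the second differs from
  \<open>P \<theta>\<close> only by a contraction of \<open>a \<bullet>\<^sub>l m - m \<bullet>\<^sub>r a\<close>, which is small. So $d$ almost commutes with
  $F$ as soon as the average is almost invariant under translation by $\rho$. Averages that are almost
  invariant under any finite set of translations exist in every commutative group
  (\<open>almost_invariant_multiset\<close>).

  Testing on the functions $e^{i\rho}a$ is enough: their span is dense in $C(X,A)$
  (\<open>span_phases_dense\<close>), and for uniformly bounded elements of the tensor product approximate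
  centrality and the approximate unit property pass to the closed span
  (\<open>has_bounded_approximate_diagonal_generators\<close>).
\<close>

section \<open>Almost invariant averages\<close>

lemma sum_mset_sum: "(\<Sum>x\<in>#(\<Sum>i\<in>I. M i). f x) = (\<Sum>i\<in>I. \<Sum>x\<in>#M i. f x)"
  by (induction I rule: infinite_finite_induct) auto

definition mset_avg :: "'i multiset \<Rightarrow> ('i \<Rightarrow> 'v) \<Rightarrow> 'v :: real_vector"
  where "mset_avg L P = (1 / real (size L)) *\<^sub>R (\<Sum>i\<in>#L. P i)"

lemma norm_sum_mset_le:
  fixes P :: "'i \<Rightarrow> 'v :: real_normed_vector"
  assumes "\<And>i. norm (P i) \<le> C"
  shows "norm (\<Sum>i\<in>#L. P i) \<le> C * real (size L)"
proof (induction L)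
  case (add i L)
  then show ?case
    using norm_triangle_ineq [of "P i" "\<Sum>i\<in>#L. P i"] assms [of i] by (simp add: algebra_simps)
qed simp

lemma norm_mset_avg_le:
  fixes P :: "'i \<Rightarrow> 'v :: real_normed_vector"
  assumes "\<And>i. norm (P i) \<le> C"
  shows "norm (mset_avg L P) \<le> C"
proof (cases "L = {#}")
  case True
  then show ?thesis
    using order_trans [OF norm_ge_zero assms] by (simp add: mset_avg_def)
next
  case False
  then have "0 < real (size L)" by (simp add: nonempty_has_size)
  then show ?thesis
    using norm_sum_mset_le [of P C L, OF assms] by (simp add: mset_avg_def field_simps)
qed

lemma mset_avg_diff: "mset_avg L P - mset_avg L Q = mset_avg L (\<lambda>i. P i - Q i)"
proof -
  have "(\<Sum>i\<in>#L. P i) - (\<Sum>i\<in>#L. Q i) = (\<Sum>i\<in>#L. P i - Q i)" by (induction L) auto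
  then show ?thesis by (simp add: mset_avg_def flip: scaleR_diff_right)
qed

lemma mset_avg_const: "L \<noteq> {#} \<Longrightarrow> mset_avg L (\<lambda>_. v) = v"
proof -
  have "(\<Sum>i\<in>#L. v) = real (size L) *\<^sub>R v" by (induction L) (auto simp: scaleR_add_left)
  moreover assume "L \<noteq> {#}"
  ultimately show ?thesis by (simp add: mset_avg_def)
qed

lemma linear_mset_avg:
  assumes "linear h"
  shows "h (mset_avg L P) = mset_avg L (\<lambda>i. h (P i))"
proof -
  have "h (\<Sum>i\<in>#L. P i) = (\<Sum>i\<in>#L. h (P i))"
    by (induction L) (auto simp: linear_0 [OF assms] linear_add [OF assms])
  then show ?thesis by (simp add: mset_avg_def linear_cmul [OF assms])
qed

text \<open>
  Amenability of a commutative monoid, in the form of Folner's condition. One translation \<open>t\<close> is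
  handled by averaging over \<open>0, t, 2t, \<dots>, (N - 1)t\<close>: the difference telescopes to two of the \<open>N\<close>
  terms. For several translations this replaces \<open>L\<close> by \<open>N\<close> translates of itself, once for each.
  Because the estimate is required for every bounded \<open>P\<close>, and so also for the translates of \<open>P\<close> by
  multiples of the new element, the earlier estimates survive each step.
\<close>

lemma almost_invariant_multiset:
  fixes S :: "'g :: comm_monoid_add set"
  assumes "finite S" "0 < N"
  obtains L :: "'g multiset" where "L \<noteq> {#}"
    and "\<And>(P :: 'g \<Rightarrow> 'v :: real_normed_vector) C s. s \<in> S \<Longrightarrow> (\<And>g. norm (P g) \<le> C) \<Longrightarrow>
      norm (mset_avg L (\<lambda>g. P (s + g)) - mset_avg L P) \<le> 2 * C / real N"
proof -
  have "\<exists>L :: 'g multiset. L \<noteq> {#} \<and> (\<forall>s\<in>S. \<forall>(P :: 'g \<Rightarrow> 'v) C. (\<forall>g. norm (P g) \<le> C) \<longrightarrow>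
      norm ((\<Sum>g\<in>#L. P (s + g)) - (\<Sum>g\<in>#L. P g)) \<le> 2 * C / real N * real (size L))"
    using assms(1)
  proof induction
    case empty
    show ?case by (intro exI [of _ "{#0#}"]) simp
  next
    case (insert t S)
    then obtain L :: "'g multiset" where L: "L \<noteq> {#}"
      and inv: "\<And>(P :: 'g \<Rightarrow> 'v) C s. s \<in> S \<Longrightarrow> (\<And>g. norm (P g) \<le> C) \<Longrightarrow>
        norm ((\<Sum>g\<in>#L. P (s + g)) - (\<Sum>g\<in>#L. P g)) \<le> 2 * C / real N * real (size L)"
      by blast
    \<comment> \<open>\<open>sh n\<close> is translation by \<open>n\<close> times \<open>t\<close>.\<close>
    define sh where "sh n = ((+) t ^^ n)" for n
    have sh_Suc: "t + sh n g = sh (Suc n) g" for n g by (simp add: sh_def)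
    have sh_add: "s + sh n g = sh n (s + g)" for s n g
      by (induction n) (simp_all add: sh_def add.left_commute [of s t])
    define L' where "L' = (\<Sum>n<N. image_mset (sh n) L)"
    have sum_L': "(\<Sum>g\<in>#L'. P g) = (\<Sum>n<N. \<Sum>g\<in>#L. P (sh n g))" for P :: "'g \<Rightarrow> 'v"
      by (simp add: L'_def sum_mset_sum multiset.map_comp comp_def)
    have size_L': "size L' = N * size L" by (simp add: L'_def)
    have "norm ((\<Sum>g\<in>#L'. P (s + g)) - (\<Sum>g\<in>#L'. P g)) \<le> 2 * C / real N * real (size L')"
      if s: "s \<in> insert t S" and P: "\<And>g. norm (P g) \<le> C" for s and P :: "'g \<Rightarrow> 'v" and C
    proof (cases "s = t")
      case True
      have "(\<Sum>g\<in>#L'. P (s + g)) - (\<Sum>g\<in>#L'. P g) =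
          (\<Sum>n<N. (\<Sum>g\<in>#L. P (sh (Suc n) g)) - (\<Sum>g\<in>#L. P (sh n g)))"
        by (simp add: sum_L' True sh_Suc sum_subtractf)
      also have "\<dots> = (\<Sum>g\<in>#L. P (sh N g)) - (\<Sum>g\<in>#L. P (sh 0 g))"
        by (rule sum_lessThan_telescope)
      also have "norm \<dots> \<le> C * size L + C * size L"
        by (intro order_trans [OF norm_triangle_ineq4] add_mono norm_sum_mset_le P)
      also have "\<dots> = 2 * C / real N * real (size L')"
        using \<open>0 < N\<close> by (simp add: size_L')
      finally show ?thesis .
    next
      case False
      then have "s \<in> S" using s by simp
      have "norm ((\<Sum>g\<in>#L'. P (s + g)) - (\<Sum>g\<in>#L'. P g)) =
          norm (\<Sum>n<N. (\<Sum>g\<in>#L. P (sh n (s + g))) - (\<Sum>g\<in>#L. P (sh n g)))"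
        by (simp add: sum_L' sh_add sum_subtractf)
      also have "\<dots> \<le> (\<Sum>n<N. 2 * C / real N * real (size L))"
        by (intro sum_norm_le inv [OF \<open>s \<in> S\<close>] P)
      finally show ?thesis by (simp add: size_L' algebra_simps)
    qed
    moreover have "L' \<noteq> {#}"
      using L \<open>0 < N\<close> size_L' by auto
    ultimately show ?case by blast
  qed
  then obtain L :: "'g multiset" where L: "L \<noteq> {#}"
    and inv: "\<And>(P :: 'g \<Rightarrow> 'v) C s. s \<in> S \<Longrightarrow> (\<And>g. norm (P g) \<le> C) \<Longrightarrow>
      norm ((\<Sum>g\<in>#L. P (s + g)) - (\<Sum>g\<in>#L. P g)) \<le> 2 * C / real N * real (size L)"
    by blast
  have "norm (mset_avg L (\<lambda>g. P (s + g)) - mset_avg L P) \<le> 2 * C / real N"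
    if "s \<in> S" "\<And>g. norm (P g) \<le> C" for P :: "'g \<Rightarrow> 'v" and C s
  proof -
    have "mset_avg L (\<lambda>g. P (s + g)) - mset_avg L P =
        (1 / real (size L)) *\<^sub>R ((\<Sum>g\<in>#L. P (s + g)) - (\<Sum>g\<in>#L. P g))"
      by (simp add: mset_avg_def scaleR_diff_right)
    then show ?thesis
      using inv [OF that] L by (simp add: nonempty_has_size divide_le_eq)
  qed
  with L show thesis by (rule that)
qed

section \<open>Bounded linear maps on projective tensor products\<close>

text \<open>
  Elementary tensors span the algebraic tensor product, which is dense in its completion. All
  identities between module operations below are reduced to elementary tensors in this way.
\<close>

lemma bounded_linear_eq_on_tensors:
  fixes H K :: "'a :: complex_normed_vector \<otimes>\<^sub>\<pi> 'b :: complex_normed_vector \<Rightarrow>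
    'c :: real_normed_vector"
  assumes H: "bounded_linear H" and K: "bounded_linear K"
    and eq: "\<And>a b. H (of_alg_tensor (a \<otimes>\<^sub>a b)) = K (of_alg_tensor (a \<otimes>\<^sub>a b))"
  shows "H u = K u"
proof -
  interpret H: bounded_linear H by (rule H)
  interpret K: bounded_linear K by (rule K)
  have "of_alg_tensor 0 = (0 :: 'a \<otimes>\<^sub>\<pi> 'b)"
    using of_alg_tensor_add [of "0 :: ('a, 'b) alg_tensor" 0] by simp
  then have "H (of_alg_tensor (\<Sum>(a, b)\<in>#M. a \<otimes>\<^sub>a b)) =
      K (of_alg_tensor (\<Sum>(a, b)\<in>#M. a \<otimes>\<^sub>a b))" for M
    by (induction M) (auto simp: of_alg_tensor_add H.add K.add H.zero K.zero eq)
  then have alg: "H (of_alg_tensor t) = K (of_alg_tensor t)" for t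
    by (metis alg_tensor_cases)
  obtain U where U: "proj_Cauchy U" "u = abs_proj_tensor U" by (rule proj_tensor_cases)
  have "(\<lambda>n. K (of_alg_tensor (U n))) \<longlonglongrightarrow> H u"
    using H.tendsto [OF of_alg_tensor_LIMSEQ [OF U(1)]] by (simp add: alg U(2))
  moreover have "(\<lambda>n. K (of_alg_tensor (U n))) \<longlonglongrightarrow> K u"
    using K.tendsto [OF of_alg_tensor_LIMSEQ [OF U(1)]] by (simp add: U(2))
  ultimately show ?thesis by (rule LIMSEQ_unique)
qed

text \<open>
  Termwise application to representing Cauchy sequences is compatible with the quotient only for
  Lipschitz maps; the default value makes the operation total.
\<close>

lift_definition extend_lipschitz ::
    "(('a :: complex_normed_vector, 'b :: complex_normed_vector) alg_tensor \<Rightarrow>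
      ('c :: complex_normed_vector, 'd :: complex_normed_vector) alg_tensor) \<Rightarrow>
     'a \<otimes>\<^sub>\<pi> 'b \<Rightarrow> 'c \<otimes>\<^sub>\<pi> 'd"
  is "\<lambda>F U n. if \<exists>k. \<forall>u v. proj_norm (F u - F v) \<le> k * proj_norm (u - v) then F (U n) else 0"
proof -
  fix F :: "('a, 'b) alg_tensor \<Rightarrow> ('c, 'd) alg_tensor" and U V :: "nat \<Rightarrow> ('a, 'b) alg_tensor"
  let ?lip = "\<exists>k. \<forall>u v. proj_norm (F u - F v) \<le> k * proj_norm (u - v)"
  assume UV: "proj_rel U V"
  show "proj_rel (\<lambda>n. if ?lip then F (U n) else 0) (\<lambda>n. if ?lip then F (V n) else 0)"
  proof (cases ?lip)
    case True
    then obtain k where "\<And>u v. proj_norm (F u - F v) \<le> k * proj_norm (u - v)" by blast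
    then have "proj_rel (\<lambda>n. F (U n)) (\<lambda>n. F (V n))" by (rule proj_rel_lipschitz [OF UV])
    with True show ?thesis by simp
  next
    case False
    then show ?thesis by (simp only: if_False) (simp add: proj_rel_refl)
  qed
qed

lemma extend_lipschitz_abs:
  assumes "\<And>u v. proj_norm (F u - F v) \<le> k * proj_norm (u - v)" "proj_Cauchy U"
  shows "extend_lipschitz F (abs_proj_tensor U) = abs_proj_tensor (\<lambda>n. F (U n))"
proof -
  have "\<exists>k. \<forall>u v. proj_norm (F u - F v) \<le> k * proj_norm (u - v)" using assms(1) by blast
  with assms(2) show ?thesis by (simp add: extend_lipschitz.abs_eq proj_rel_refl)
qed

text \<open>
  The projective norm is functorial: applying \<open>f\<close> and \<open>g\<close> to the factors of any representation of
  \<open>u\<close> gives a representation of the image whose cost is at most \<open>k * l\<close> times as large.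
\<close>

lemma tensor_product_of_bounded_maps:
  fixes f :: "'a :: complex_normed_vector \<Rightarrow> 'c :: complex_normed_vector"
    and g :: "'b :: complex_normed_vector \<Rightarrow> 'd :: complex_normed_vector"
  assumes f: "\<And>x y. f (x + y) = f x + f y" "\<And>c x. f (c *\<^sub>C x) = c *\<^sub>C f x"
      "\<And>x. norm (f x) \<le> k * norm x"
    and g: "\<And>x y. g (x + y) = g x + g y" "\<And>c x. g (c *\<^sub>C x) = c *\<^sub>C g x"
      "\<And>x. norm (g x) \<le> l * norm x"
    and "0 \<le> k" "0 \<le> l"
  obtains T where "bounded_linear T"
    "\<And>a b. T (of_alg_tensor (a \<otimes>\<^sub>a b)) = of_alg_tensor (f a \<otimes>\<^sub>a g b)"
    "\<And>u. norm (T u) \<le> k * l * norm u"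
proof -
  obtain F where F: "\<And>u v. F (u + v) = F u + F v" "\<And>c u. F (c *\<^sub>C u) = c *\<^sub>C F u"
      "\<And>a b. F (a \<otimes>\<^sub>a b) = f a \<otimes>\<^sub>a g b"
    using alg_tensor_universal [of "\<lambda>a b. f a \<otimes>\<^sub>a g b"]
    by (auto simp: f g tensor_add_left tensor_add_right tensor_scaleC_left tensor_scaleC_right)
  have F0: "F 0 = 0" using F(1) [of 0 0] by simp
  have F_diff: "F (u - v) = F u - F v" for u v using F(1) [of "u - v" v] by simp
  have F_le: "proj_norm (F u) \<le> k * l * proj_norm u" for u
  proof (rule proj_norm_bound)
    fix M :: "('a \<times> 'b) multiset" assume M: "u = (\<Sum>(a, b)\<in>#M. a \<otimes>\<^sub>a b)"
    have "proj_norm (F (\<Sum>(a, b)\<in>#M. a \<otimes>\<^sub>a b)) \<le> k * l * (\<Sum>(a, b)\<in>#M. norm a * norm b)"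
    proof (induction M)
      case (add p M)
      obtain a b where p: "p = (a, b)" by force
      have "proj_norm (f a \<otimes>\<^sub>a g b) \<le> norm (f a) * norm (g b)"
        using proj_norm_le [of "f a \<otimes>\<^sub>a g b" "{#(f a, g b)#}"] by simp
      also have "\<dots> \<le> (k * norm a) * (l * norm b)"
        using f(3) g(3) \<open>0 \<le> k\<close> by (intro mult_mono) auto
      finally have "proj_norm (f a \<otimes>\<^sub>a g b) \<le> k * l * (norm a * norm b)"
        by (simp add: mult_ac)
      then show ?case
        using add.IH proj_norm_triangle [of "f a \<otimes>\<^sub>a g b" "F (\<Sum>(a, b)\<in>#M. a \<otimes>\<^sub>a b)"]
        by (simp add: p F distrib_left)
    qed (simp add: F0)
    with M show "proj_norm (F u) \<le> k * l * (\<Sum>(a, b)\<in>#M. norm a * norm b)" by simp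
  qed (use \<open>0 \<le> k\<close> \<open>0 \<le> l\<close> in simp)
  then have lip: "proj_norm (F u - F v) \<le> k * l * proj_norm (u - v)" for u v
    by (simp flip: F_diff)
  note abs = extend_lipschitz_abs [OF lip] and Cauchy = proj_Cauchy_lipschitz [OF _ lip]
  let ?T = "extend_lipschitz F"
  have T_le: "norm (?T u) \<le> k * l * norm u" for u
  proof -
    obtain U where U: "proj_Cauchy U" "u = abs_proj_tensor U" by (rule proj_tensor_cases)
    have "(\<lambda>n. proj_norm (F (U n))) \<longlonglongrightarrow> norm (?T u)"
      using norm_proj_tensor_lim [OF Cauchy [OF U(1)]] U by (simp add: abs)
    moreover have "(\<lambda>n. k * l * proj_norm (U n)) \<longlonglongrightarrow> k * l * norm u"
      using U norm_proj_tensor_lim by (auto intro!: tendsto_mult)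
    ultimately show ?thesis by (rule LIMSEQ_le) (auto intro: F_le)
  qed
  show thesis
  proof
    show "bounded_linear ?T"
    proof (rule bounded_linear_intro [where K = "k * l"])
      fix u v :: "'a \<otimes>\<^sub>\<pi> 'b" and r :: real
      obtain U where U: "proj_Cauchy U" "u = abs_proj_tensor U" by (rule proj_tensor_cases)
      obtain V where V: "proj_Cauchy V" "v = abs_proj_tensor V" by (rule proj_tensor_cases)
      show "?T (u + v) = ?T u + ?T v"
        using U V by (simp add: abs Cauchy F plus_proj_tensor.abs_eq proj_rel_refl proj_Cauchy_add)
      have "proj_Cauchy (\<lambda>n. complex_of_real r *\<^sub>C U n)"
          "proj_Cauchy (\<lambda>n. complex_of_real r *\<^sub>C F (U n))"
        using U(1) Cauchy [OF U(1)]
        by (auto intro: proj_Cauchy_lipschitz [where F = "scaleC _"]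
            simp: proj_norm_scaleC simp flip: scaleC_diff_right)
      then show "?T (r *\<^sub>R u) = r *\<^sub>R ?T u"
        using U by (simp add: abs Cauchy F scaleC_proj_tensor.abs_eq proj_rel_refl
            flip: scaleC_of_real)
      show "norm (?T u) \<le> norm u * (k * l)" using T_le [of u] by (simp add: mult.commute)
    qed
    show "?T (of_alg_tensor (a \<otimes>\<^sub>a b)) = of_alg_tensor (f a \<otimes>\<^sub>a g b)" for a b
      by (simp add: of_alg_tensor.abs_eq proj_rel_refl abs F)
  qed (rule T_le)
qed

lemma norm_lact_le: "norm (a \<bullet>\<^sub>l u) \<le> norm a * norm u"
proof -
  obtain U where U: "proj_Cauchy U" "u = abs_proj_tensor U" by (rule proj_tensor_cases)
  have "(\<lambda>n. proj_norm (alg_lact a (U n))) \<longlonglongrightarrow> norm (a \<bullet>\<^sub>l u)"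
    using norm_proj_tensor_lim [OF proj_Cauchy_lact [OF U(1)]] U
    by (simp add: lact.abs_eq proj_rel_refl)
  moreover have "(\<lambda>n. norm a * proj_norm (U n)) \<longlonglongrightarrow> norm a * norm u"
    using U norm_proj_tensor_lim by (auto intro!: tendsto_mult)
  ultimately show ?thesis by (rule LIMSEQ_le) (auto intro: proj_norm_alg_lact)
qed

lemma norm_ract_le: "norm (u \<bullet>\<^sub>r a) \<le> norm a * norm u"
proof -
  obtain U where U: "proj_Cauchy U" "u = abs_proj_tensor U" by (rule proj_tensor_cases)
  have "(\<lambda>n. proj_norm (alg_ract (U n) a)) \<longlonglongrightarrow> norm (u \<bullet>\<^sub>r a)"
    using norm_proj_tensor_lim [OF proj_Cauchy_ract [OF U(1)]] U
    by (simp add: ract.abs_eq proj_rel_refl)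
  moreover have "(\<lambda>n. norm a * proj_norm (U n)) \<longlonglongrightarrow> norm a * norm u"
    using U norm_proj_tensor_lim by (auto intro!: tendsto_mult)
  ultimately show ?thesis by (rule LIMSEQ_le) (auto intro: proj_norm_alg_ract)
qed

lemma norm_proj_prod_le: "norm (proj_prod u) \<le> norm u"
proof -
  obtain U where U: "proj_Cauchy U" "u = abs_proj_tensor U" by (rule proj_tensor_cases)
  have "(\<lambda>n. norm (alg_prod (U n))) \<longlonglongrightarrow> norm (proj_prod u)"
    using proj_prod_lim [OF U(1)] U by (auto intro!: tendsto_norm)
  moreover have "(\<lambda>n. proj_norm (U n)) \<longlonglongrightarrow> norm u"
    using U norm_proj_tensor_lim by auto
  ultimately show ?thesis by (rule LIMSEQ_le) (auto intro: norm_alg_prod)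
qed

lemma tensor_scaleR_left: "(r *\<^sub>R a) \<otimes>\<^sub>a b = r *\<^sub>R (a \<otimes>\<^sub>a b)"
  by (simp add: tensor_scaleC_left flip: scaleC_of_real)

lemma tensor_scaleR_right: "a \<otimes>\<^sub>a (r *\<^sub>R b) = r *\<^sub>R (a \<otimes>\<^sub>a b)"
  by (simp add: tensor_scaleC_right flip: scaleC_of_real)

lemma of_alg_tensor_scaleR: "of_alg_tensor (r *\<^sub>R u) = r *\<^sub>R of_alg_tensor u"
  by (simp add: of_alg_tensor_scaleC flip: scaleC_of_real)

lemma bounded_linear_lact_left: "bounded_linear (\<lambda>a. a \<bullet>\<^sub>l u)"
proof (rule bounded_linear_intro [where K = "norm u"])
  note bl = bounded_linear_lact bounded_linear_add
    bounded_linear_compose [OF bounded_linear_scaleR_right]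
  show "(a + b) \<bullet>\<^sub>l u = a \<bullet>\<^sub>l u + b \<bullet>\<^sub>l u" for a b
    by (rule bounded_linear_eq_on_tensors [of "lact (a + b)"])
      (auto intro: bl simp: lact_tensor distrib_right tensor_add_left of_alg_tensor_add)
  show "(r *\<^sub>R a) \<bullet>\<^sub>l u = r *\<^sub>R (a \<bullet>\<^sub>l u)" for r a
    by (rule bounded_linear_eq_on_tensors [of "lact (r *\<^sub>R a)"])
      (auto intro: bl simp: lact_tensor tensor_scaleR_left of_alg_tensor_scaleR)
qed (rule norm_lact_le)

lemma bounded_linear_ract_right: "bounded_linear (\<lambda>a. u \<bullet>\<^sub>r a)"
proof (rule bounded_linear_intro [where K = "norm u"])
  note bl = bounded_linear_ract bounded_linear_add
    bounded_linear_compose [OF bounded_linear_scaleR_right]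
  show "u \<bullet>\<^sub>r (a + b) = u \<bullet>\<^sub>r a + u \<bullet>\<^sub>r b" for a b
    by (rule bounded_linear_eq_on_tensors [of "\<lambda>u. u \<bullet>\<^sub>r (a + b)"])
      (auto intro: bl simp: ract_tensor distrib_left tensor_add_right of_alg_tensor_add)
  show "u \<bullet>\<^sub>r (r *\<^sub>R a) = r *\<^sub>R (u \<bullet>\<^sub>r a)" for r a
    by (rule bounded_linear_eq_on_tensors [of "\<lambda>u. u \<bullet>\<^sub>r (r *\<^sub>R a)"])
      (auto intro: bl simp: ract_tensor tensor_scaleR_right of_alg_tensor_scaleR)
qed (rule norm_ract_le)

section \<open>Testing approximate diagonals on finite sets\<close>

text \<open>
  The net disappears from the problem here and reappears in
  \<open>has_bounded_approximate_diagonal_generators\<close>: a bounded approximate diagonal exists iff there is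
  one bound under which every finite set can be served to every precision.
\<close>

lemma has_bounded_approximate_diagonalD:
  assumes "has_bounded_approximate_diagonal TYPE('b :: complex_banach_algebra)"
  obtains K where "0 < K"
    "\<And>(S :: 'b set) e. finite S \<Longrightarrow> 0 < e \<Longrightarrow> \<exists>u. norm u \<le> K \<and>
      (\<forall>a\<in>S. norm (a \<bullet>\<^sub>l u - u \<bullet>\<^sub>r a) < e \<and> norm (proj_prod u * a - a) < e)"
proof -
  obtain I le and u :: "('b \<otimes>\<^sub>\<pi> 'b) set \<times> 'b \<otimes>\<^sub>\<pi> 'b \<Rightarrow> 'b \<otimes>\<^sub>\<pi> 'b"
    where dir: "directed I le"
    and lim: "\<And>a. ((\<lambda>i. a \<bullet>\<^sub>l u i - u i \<bullet>\<^sub>r a) \<longlongrightarrow> 0) (net_filter I le)"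
      "\<And>a. ((\<lambda>i. proj_prod (u i) * a) \<longlongrightarrow> a) (net_filter I le)"
    and bdd: "bounded (u ` I)"
    using assms unfolding has_bounded_approximate_diagonal_def
      bounded_approximate_diagonal_def approximate_diagonal_def by blast
  obtain K where K: "0 < K" "\<And>i. i \<in> I \<Longrightarrow> norm (u i) \<le> K"
    using bdd by (auto simp: bounded_pos)
  have "\<exists>u. norm u \<le> K \<and>
      (\<forall>a\<in>S. norm (a \<bullet>\<^sub>l u - u \<bullet>\<^sub>r a) < e \<and> norm (proj_prod u * a - a) < e)"
    if S: "finite S" and e: "0 < e" for S :: "'b set" and e
  proof -
    have "\<forall>\<^sub>F i in net_filter I le. \<forall>a\<in>S.
        norm (a \<bullet>\<^sub>l u i - u i \<bullet>\<^sub>r a) < e \<and> norm (proj_prod (u i) * a - a) < e"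
      using tendstoD [OF lim(1) e] tendstoD [OF lim(2) e]
      by (intro eventually_ball_finite [OF S] ballI eventually_conj) (simp_all add: dist_norm)
    then obtain i where i: "i \<in> I" "\<forall>j\<in>I. le i j \<longrightarrow> (\<forall>a\<in>S.
        norm (a \<bullet>\<^sub>l u j - u j \<bullet>\<^sub>r a) < e \<and> norm (proj_prod (u j) * a - a) < e)"
      unfolding eventually_net_filter [OF dir] by blast
    moreover have "le i i" using dir i(1) by (simp add: directed_def)
    ultimately show ?thesis using K by blast
  qed
  with K(1) show thesis by (rule that)
qed

text \<open>
  The easy half of the Banach-Steinhaus theorem: uniform boundedness carries pointwise convergence
  from a set to its closed span.
\<close>

lemma tendsto_zero_on_closure_span:
  fixes \<Phi> :: "'i \<Rightarrow> 'b :: real_normed_vector \<Rightarrow> 'c :: real_normed_vector"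
  assumes lin: "\<And>i. linear (\<Phi> i)"
    and bd: "\<forall>\<^sub>F i in F. \<forall>a. norm (\<Phi> i a) \<le> C * norm a"
    and G: "\<And>a. a \<in> G \<Longrightarrow> ((\<lambda>i. \<Phi> i a) \<longlongrightarrow> 0) F"
    and a: "a \<in> closure (span G)"
  shows "((\<lambda>i. \<Phi> i a) \<longlongrightarrow> 0) F"
proof (rule tendstoI)
  have span: "((\<lambda>i. \<Phi> i b) \<longlongrightarrow> 0) F" if "b \<in> span G" for b
    using that
  proof (induction rule: span_induct_alt)
    case base
    show ?case by (simp add: linear_0 [OF lin])
  next
    case (step c x y)
    have "((\<lambda>i. c *\<^sub>R \<Phi> i x + \<Phi> i y) \<longlongrightarrow> c *\<^sub>R 0 + 0) F"
      using step G by (intro tendsto_intros)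
    then show ?case by (simp add: linear_add [OF lin] linear_cmul [OF lin])
  qed
  fix e :: real assume e: "0 < e"
  define C' where "C' = max C 1"
  have C': "0 < C'" "C \<le> C'" by (auto simp: C'_def)
  obtain b where b: "b \<in> span G" "dist b a < e / (2 * C')"
    using a e C'(1) unfolding closure_approachable
    by (metis divide_pos_pos mult_pos_pos zero_less_numeral)
  have "\<forall>\<^sub>F i in F. norm (\<Phi> i b) < e / 2"
    using tendstoD [OF span [OF b(1)], of "e / 2"] e by simp
  with bd show "\<forall>\<^sub>F i in F. dist (\<Phi> i a) 0 < e"
  proof eventually_elim
    case (elim i)
    have "norm (\<Phi> i (a - b)) \<le> C * norm (a - b)" using elim(1) by blast
    also have "\<dots> \<le> C' * norm (a - b)" using C' by (intro mult_right_mono) auto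
    also have "\<dots> < C' * (e / (2 * C'))"
      using b(2) C' by (intro mult_strict_left_mono) (auto simp: dist_norm norm_minus_commute)
    also have "\<dots> = e / 2" using C' by simp
    finally have "norm (\<Phi> i (a - b)) < e / 2" .
    moreover have "\<Phi> i a = \<Phi> i (a - b) + \<Phi> i b" by (simp add: linear_diff [OF lin])
    ultimately show ?case
      using elim(2) norm_triangle_ineq [of "\<Phi> i (a - b)" "\<Phi> i b"] by simp
  qed
qed

text \<open>
  The net is indexed by finite subsets of \<open>G\<close> together with a precision. Both
  conditions are first shown on \<open>G\<close> and then pass to the closed span as limits along a net that is
  already fixed, so that no precision has to be divided among the terms of a linear combination.
\<close>

lemma has_bounded_approximate_diagonal_generators:
  fixes G :: "'b :: complex_banach_algebra set"
  assumes dense: "closure (span G) = UNIV"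
    and ex: "\<And>S e. finite S \<Longrightarrow> S \<subseteq> G \<Longrightarrow> 0 < e \<Longrightarrow> \<exists>u. norm u \<le> K \<and>
      (\<forall>a\<in>S. norm (a \<bullet>\<^sub>l u - u \<bullet>\<^sub>r a) < e \<and> norm (proj_prod u * a - a) < e)"
  shows "has_bounded_approximate_diagonal TYPE('b)"
proof -
  define I :: "('b set \<times> nat) set" where "I = {(S, n). finite S \<and> S \<subseteq> G}"
  define le where "le p q \<longleftrightarrow> fst p \<subseteq> fst q \<and> snd p \<le> snd q" for p q :: "'b set \<times> nat"
  have dir: "directed I le"
    unfolding directed_def
  proof (intro conjI ballI impI)
    show "I \<noteq> {}" by (auto simp: I_def)
  next
    fix p q assume "p \<in> I" "q \<in> I"
    then show "\<exists>r\<in>I. le p r \<and> le q r"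
      by (intro bexI [of _ "(fst p \<union> fst q, max (snd p) (snd q))"]) (auto simp: I_def le_def)
  qed (auto simp: le_def)
  have "\<forall>p\<in>I. \<exists>u. norm u \<le> K \<and> (\<forall>a\<in>fst p. norm (a \<bullet>\<^sub>l u - u \<bullet>\<^sub>r a) < inverse (Suc (snd p)) \<and>
      norm (proj_prod u * a - a) < inverse (Suc (snd p)))"
    by (intro ballI ex) (auto simp: I_def)
  then obtain u where u': "\<forall>p\<in>I. norm (u p) \<le> K \<and>
      (\<forall>a\<in>fst p. norm (a \<bullet>\<^sub>l u p - u p \<bullet>\<^sub>r a) < inverse (Suc (snd p)) \<and>
      norm (proj_prod (u p) * a - a) < inverse (Suc (snd p)))"
    by (rule bchoice [THEN exE])
  have u: "norm (u p) \<le> K" if "p \<in> I" for p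
    by (rule conjunct1 [OF bspec [OF u' that]])
  have small: "norm (a \<bullet>\<^sub>l u p - u p \<bullet>\<^sub>r a) < inverse (Suc (snd p)) \<and>
      norm (proj_prod (u p) * a - a) < inverse (Suc (snd p))" if "p \<in> I" "a \<in> fst p" for p a
    by (rule bspec [OF conjunct2 [OF bspec [OF u' that(1)]] that(2)])
  let ?F = "net_filter I le"
  have "\<forall>\<^sub>F p in ?F. p \<in> I"
    unfolding eventually_net_filter [OF dir]
    by (intro bexI [of _ "({}, 0)"]) (auto simp: I_def)
  then have ev: "\<forall>\<^sub>F p in ?F. norm (u p) \<le> K" by eventually_elim (rule u)
  have gen: "((\<lambda>p. \<Psi> p) \<longlongrightarrow> 0) ?F"
    if "a \<in> G" and \<Psi>: "\<And>p. p \<in> I \<Longrightarrow> a \<in> fst p \<Longrightarrow> norm (\<Psi> p) < inverse (Suc (snd p))"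
    for \<Psi> :: "_ \<Rightarrow> 'z :: real_normed_vector" and a
  proof (rule tendstoI)
    fix e :: real assume "0 < e"
    then obtain n where n: "inverse (real (Suc n)) < e" using reals_Archimedean by blast
    have "norm (\<Psi> p) < e" if p: "p \<in> I" "le ({a}, n) p" for p
    proof -
      have "inverse (real (Suc (snd p))) \<le> inverse (real (Suc n))"
        using p(2) by (auto simp: le_def intro!: le_imp_inverse_le)
      moreover have "norm (\<Psi> p) < inverse (Suc (snd p))"
        using p by (intro \<Psi>) (auto simp: le_def)
      ultimately show ?thesis using n by linarith
    qed
    then show "\<forall>\<^sub>F p in ?F. dist (\<Psi> p) 0 < e"
      unfolding eventually_net_filter [OF dir] using \<open>a \<in> G\<close>
      by (intro bexI [of _ "({a}, n)"]) (auto simp: I_def)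
  qed
  have "((\<lambda>p. a \<bullet>\<^sub>l u p - u p \<bullet>\<^sub>r a) \<longlongrightarrow> 0) ?F" for a
  proof (rule tendsto_zero_on_closure_span [where \<Phi> = "\<lambda>p a. a \<bullet>\<^sub>l u p - u p \<bullet>\<^sub>r a"])
    show "linear (\<lambda>a. a \<bullet>\<^sub>l u p - u p \<bullet>\<^sub>r a)" for p
      by (intro bounded_linear.linear bounded_linear_sub bounded_linear_lact_left
          bounded_linear_ract_right)
    show "\<forall>\<^sub>F p in ?F. \<forall>a. norm (a \<bullet>\<^sub>l u p - u p \<bullet>\<^sub>r a) \<le> (2 * K) * norm a"
      using ev
    proof eventually_elim
      case (elim p)
      show ?case
      proof
        fix a
        have "norm (a \<bullet>\<^sub>l u p - u p \<bullet>\<^sub>r a) \<le> norm a * norm (u p) + norm a * norm (u p)"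
          by (intro order_trans [OF norm_triangle_ineq4] add_mono norm_lact_le norm_ract_le)
        also have "\<dots> \<le> (2 * K) * norm a"
          using mult_left_mono [OF elim, of "norm a"] by (simp add: algebra_simps)
        finally show "norm (a \<bullet>\<^sub>l u p - u p \<bullet>\<^sub>r a) \<le> (2 * K) * norm a" .
      qed
    qed
    show "((\<lambda>p. a \<bullet>\<^sub>l u p - u p \<bullet>\<^sub>r a) \<longlongrightarrow> 0) ?F" if "a \<in> G" for a
      by (rule gen [OF that]) (use small in simp)
  qed (simp add: dense)
  moreover have "((\<lambda>p. proj_prod (u p) * a) \<longlongrightarrow> a) ?F" for a
  proof (subst Lim_null,
      rule tendsto_zero_on_closure_span [where \<Phi> = "\<lambda>p a. proj_prod (u p) * a - a"])
    show "linear (\<lambda>a. proj_prod (u p) * a - a)" for p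
      by (intro bounded_linear.linear bounded_linear_sub bounded_linear_mult_right
          bounded_linear_ident)
    show "\<forall>\<^sub>F p in ?F. \<forall>a. norm (proj_prod (u p) * a - a) \<le> (K + 1) * norm a"
      using ev
    proof eventually_elim
      case (elim p)
      show ?case
      proof
        fix a
        have "norm (proj_prod (u p) * a - a) \<le> norm (proj_prod (u p)) * norm a + norm a"
          by (intro order_trans [OF norm_triangle_ineq4] add_mono norm_mult_ineq order_refl)
        also have "\<dots> \<le> K * norm a + norm a"
          using order_trans [OF norm_proj_prod_le elim]
          by (intro add_right_mono mult_right_mono) auto
        finally show "norm (proj_prod (u p) * a - a) \<le> (K + 1) * norm a"
          by (simp add: algebra_simps)
      qed
    qed
    show "((\<lambda>p. proj_prod (u p) * a - a) \<longlongrightarrow> 0) ?F" if "a \<in> G" for a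
      by (rule gen [OF that]) (use small in simp)
  qed (simp add: dense)
  moreover have "bounded (u ` I)" unfolding bounded_iff using u by (intro exI [of _ K]) blast
  ultimately have "bounded_approximate_diagonal I le u"
    unfolding bounded_approximate_diagonal_def approximate_diagonal_def using dir by blast
  then show ?thesis by (rule has_bounded_approximate_diagonalI)
qed

section \<open>Phase functions\<close>

text \<open>
  The function $e^{i\theta}a$. Indexing unimodular functions by their real arguments turns their
  multiplication into addition in the vector space of real continuous functions.
\<close>

context includes bcontfun.lifting begin

lift_definition phase ::
    "('x :: topological_space \<Rightarrow>\<^sub>C real) \<Rightarrow> 'a :: complex_banach_algebra \<Rightarrow> 'x \<Rightarrow>\<^sub>C 'a"
  is "\<lambda>\<theta> a x. cis (\<theta> x) *\<^sub>C a"
proof -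
  fix \<theta> :: "'x \<Rightarrow> real" and a :: 'a assume \<theta>: "\<theta> \<in> bcontfun"
  have "bounded_linear (\<lambda>c. c *\<^sub>C a)"
    by (intro bounded_linear_intro [where K = "norm a"])
      (auto simp: scaleC_add_left norm_scaleC scaleR_conv_of_real scaleC_of_real
        simp flip: scaleC_scaleC)
  moreover have "continuous_on UNIV (\<lambda>x. cis (\<theta> x))"
    using \<theta> by (auto simp: bcontfun_def intro!: continuous_intros)
  ultimately show "(\<lambda>x. cis (\<theta> x) *\<^sub>C a) \<in> bcontfun"
    by (intro bcontfun_normI [where b = "norm a"])
      (auto intro: bounded_linear.continuous_on simp: norm_scaleC)
qed

end

lemma phase_apply [simp]: "phase \<theta> a x = cis (\<theta> x) *\<^sub>C a"
  by (simp add: phase.rep_eq)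

lemma phase_add: "phase \<theta> (a + b) = phase \<theta> a + phase \<theta> b"
  by (rule bcontfun_eqI) (simp add: scaleC_add_right)

lemma phase_diff: "phase \<theta> (a - b) = phase \<theta> a - phase \<theta> b"
  by (rule bcontfun_eqI) (simp add: scaleC_diff_right)

lemma phase_scaleC: "phase \<theta> (c *\<^sub>C a) = c *\<^sub>C phase \<theta> a"
  by (rule bcontfun_eqI) (simp add: mult.commute)

lemma phase_mult: "phase \<sigma> a * phase \<tau> b = phase (\<sigma> + \<tau>) (a * b)"
  by (rule bcontfun_eqI) (simp add: mult_scaleC_left mult_scaleC_right cis_mult add.commute)

lemma norm_phase_le: "norm (phase \<theta> a) \<le> norm a"
  by (rule norm_bound) (simp add: norm_scaleC)

lemma bounded_linear_phase: "bounded_linear (phase \<theta>)"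
  by (rule bounded_linear_intro [where K = 1])
    (simp_all add: phase_add phase_scaleC norm_phase_le flip: scaleC_of_real)

text \<open>
  By compactness \<open>F\<close> is uniformly close to a finite sum \<open>\<Sum>q. \<phi> q \<cdot> F q\<close>, where \<open>q\<close> runs over points
  of \<open>X\<close> and \<open>\<phi>\<close> is a partition of unity. The partition is made out of \<open>F\<close> itself: \<open>\<psi> q\<close> is
  positive exactly where \<open>F\<close> is close to \<open>F q\<close>. A function with values in $[0,1]$ is the mean of
  two unimodular ones, $\varphi = (e^{i\theta} + e^{-i\theta})/2$ with $\theta = \arccos \varphi$.
\<close>

lemma span_phases_dense:
  assumes X: "compact (UNIV :: 'x :: topological_space set)"
  shows "closure (span (range (case_prod phase))) =
    (UNIV :: ('x \<Rightarrow>\<^sub>C 'a :: complex_banach_algebra) set)"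
proof -
  let ?G = "range (case_prod phase) :: ('x \<Rightarrow>\<^sub>C 'a) set"
  have "F \<in> closure (span ?G)" for F
    unfolding closure_approachable
  proof (intro allI impI)
    fix e :: real assume "0 < e"
    define d where "d = e / 2"
    have d: "0 < d" "d < e" using \<open>0 < e\<close> by (auto simp: d_def)
    define \<psi> where "\<psi> q x = max 0 (d - norm (F x - F q))" for q x
    have cF: "continuous_on UNIV (apply_bcontfun F)" by simp
    have c\<psi>: "continuous_on UNIV (\<psi> q)" for q
      unfolding \<psi>_def by (intro continuous_intros cF)
    have opn: "open {x. 0 < \<psi> q x}" for q
      using c\<psi> by (intro open_Collect_less) auto
    have "x \<in> {y. 0 < \<psi> x y}" for x using d by (simp add: \<psi>_def)
    then have cover: "UNIV \<subseteq> (\<Union>q\<in>UNIV. {x. 0 < \<psi> q x})" by blast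
    obtain Q where Q: "finite Q" "UNIV \<subseteq> (\<Union>q\<in>Q. {x. 0 < \<psi> q x})"
      by (rule compactE_image [OF X opn cover])
    have \<psi>0: "0 \<le> \<psi> q x" for q x by (simp add: \<psi>_def)
    define s where "s x = (\<Sum>q\<in>Q. \<psi> q x)" for x
    have s: "0 < s x" for x
    proof -
      obtain q where "q \<in> Q" "0 < \<psi> q x" using Q(2) by blast
      then show ?thesis unfolding s_def using Q(1) \<psi>0 by (intro sum_pos2) auto
    qed
    define \<phi> where "\<phi> q x = \<psi> q x / s x" for q x
    have \<phi>0: "0 \<le> \<phi> q x" for q x using \<psi>0 s by (simp add: \<phi>_def less_imp_le)
    have \<phi>1: "\<phi> q x \<le> 1" if "q \<in> Q" for q x
      using member_le_sum [OF that, of "\<lambda>q. \<psi> q x"] \<psi>0 Q(1) s [of x]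
      by (simp add: \<phi>_def s_def)
    have sum\<phi>: "(\<Sum>q\<in>Q. \<phi> q x) = 1" for x
      using s [of x] by (simp add: \<phi>_def s_def flip: sum_divide_distrib)
    have c\<phi>: "continuous_on UNIV (\<phi> q)" for q
      unfolding \<phi>_def s_def
      by (intro continuous_intros c\<psi>) (use s in \<open>auto simp: s_def less_le\<close>)
    define \<theta> where "\<theta> q = Bcontfun (\<lambda>x. arccos (\<phi> q x))" for q
    have \<theta>: "\<theta> q x = arccos (\<phi> q x)" if "q \<in> Q" for q x
    proof -
      have "continuous_on UNIV (\<lambda>x. arccos (\<phi> q x))"
        using \<phi>0 \<phi>1 [OF that] by (intro continuous_on_arccos c\<phi>) (auto intro: order_trans [of _ 0])
      then show ?thesis
        by (simp add: \<theta>_def Bcontfun_inverse bcontfun_compact [OF X])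
    qed
    define H where "H = (\<Sum>q\<in>Q. (1/2) *\<^sub>R (phase (\<theta> q) (F q) + phase (- \<theta> q) (F q)))"
    have "H \<in> span ?G"
      unfolding H_def
      by (intro span_sum span_scale span_add span_base) (metis case_prod_conv rangeI)+
    moreover have "norm (H - F) \<le> d"
    proof (rule norm_bound)
      fix x
      have half: "((1/2) *\<^sub>R (phase (\<theta> q) (F q) + phase (- \<theta> q) (F q))) x = \<phi> q x *\<^sub>R F q"
        if "q \<in> Q" for q
      proof -
        have "(cis (\<theta> q x) + cis (- \<theta> q x)) = complex_of_real (2 * \<phi> q x)"
          using \<phi>0 [of q x] \<phi>1 [OF that, of x]
          by (auto simp: complex_eq_iff \<theta> [OF that] intro!: cos_arccos)
        then show ?thesis
          using scaleC_of_real [of "2 * \<phi> q x" "F q"] by (simp flip: scaleC_add_left)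
      qed
      have apply_sum: "apply_bcontfun (\<Sum>q\<in>R. h q) x = (\<Sum>q\<in>R. apply_bcontfun (h q) x)"
        for R :: "'x set" and h :: "'x \<Rightarrow> 'x \<Rightarrow>\<^sub>C 'a"
        by (induction R rule: infinite_finite_induct) auto
      have "(H - F) x = (\<Sum>q\<in>Q. \<phi> q x *\<^sub>R F q) - (\<Sum>q\<in>Q. \<phi> q x) *\<^sub>R F x"
        by (simp add: H_def apply_sum half sum\<phi> del: plus_bcontfun.rep_eq scaleR_bcontfun.rep_eq)
      also have "\<dots> = (\<Sum>q\<in>Q. \<phi> q x *\<^sub>R (F q - F x))"
        by (simp add: scaleR_sum_left scaleR_diff_right sum_subtractf)
      also have "norm \<dots> \<le> (\<Sum>q\<in>Q. \<phi> q x * d)"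
      proof (rule sum_norm_le)
        fix q assume "q \<in> Q"
        show "norm (\<phi> q x *\<^sub>R (F q - F x)) \<le> \<phi> q x * d"
        proof (cases "\<phi> q x = 0")
          case False
          then have "norm (F q - F x) \<le> d"
            by (auto simp: \<phi>_def \<psi>_def norm_minus_commute max_def split: if_splits)
          then show ?thesis using \<phi>0 by (simp add: mult_left_mono)
        qed simp
      qed
      also have "\<dots> = d" by (simp add: sum\<phi> flip: sum_distrib_right)
      finally show "norm ((H - F) x) \<le> d" .
    qed
    then have "dist H F < e" using d by (simp add: dist_norm)
    ultimately show "\<exists>y\<in>span ?G. dist y F < e" by blast
  qed
  then show ?thesis by blast
qed

text \<open>
  The tensor product of the maps \<open>phase \<sigma>\<close> and \<open>phase \<tau>\<close>; by \<open>bounded_linear_eq_on_tensors\<close> the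
  choice is unique.
\<close>

definition phase_twist :: "('x :: topological_space \<Rightarrow>\<^sub>C real) \<Rightarrow> ('x \<Rightarrow>\<^sub>C real) \<Rightarrow>
    'a :: complex_banach_algebra \<otimes>\<^sub>\<pi> 'a \<Rightarrow> ('x \<Rightarrow>\<^sub>C 'a) \<otimes>\<^sub>\<pi> ('x \<Rightarrow>\<^sub>C 'a)"
  where "phase_twist \<sigma> \<tau> = (SOME T. bounded_linear T \<and>
    (\<forall>a b. T (of_alg_tensor (a \<otimes>\<^sub>a b)) = of_alg_tensor (phase \<sigma> a \<otimes>\<^sub>a phase \<tau> b)) \<and>
    (\<forall>u. norm (T u) \<le> norm u))"

lemma bounded_linear_phase_twist:
    "bounded_linear (phase_twist \<sigma> \<tau> :: 'a \<otimes>\<^sub>\<pi> 'a \<Rightarrow> ('x \<Rightarrow>\<^sub>C 'a) \<otimes>\<^sub>\<pi> ('x \<Rightarrow>\<^sub>C 'a))"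
  and phase_twist_tensor: "phase_twist \<sigma> \<tau> (of_alg_tensor (a \<otimes>\<^sub>a b)) =
    of_alg_tensor (phase \<sigma> a \<otimes>\<^sub>a phase \<tau> b)"
  and norm_phase_twist_le: "norm (phase_twist \<sigma> \<tau> u) \<le> norm u"
  for \<sigma> \<tau> :: "'x :: topological_space \<Rightarrow>\<^sub>C real"
    and a b :: "'a :: complex_banach_algebra" and u :: "'a \<otimes>\<^sub>\<pi> 'a"
proof -
  have "\<exists>T :: 'a \<otimes>\<^sub>\<pi> 'a \<Rightarrow> ('x \<Rightarrow>\<^sub>C 'a) \<otimes>\<^sub>\<pi> ('x \<Rightarrow>\<^sub>C 'a). bounded_linear T \<and>
      (\<forall>a b. T (of_alg_tensor (a \<otimes>\<^sub>a b)) = of_alg_tensor (phase \<sigma> a \<otimes>\<^sub>a phase \<tau> b)) \<and>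
      (\<forall>u. norm (T u) \<le> norm u)"
    by (rule tensor_product_of_bounded_maps [of "phase \<sigma> :: 'a \<Rightarrow> _" 1 "phase \<tau> :: 'a \<Rightarrow> _" 1])
      (auto simp: phase_add phase_scaleC norm_phase_le)
  note * = someI_ex [OF this, folded phase_twist_def]
  show "bounded_linear (phase_twist \<sigma> \<tau> :: 'a \<otimes>\<^sub>\<pi> 'a \<Rightarrow> _)"
    "phase_twist \<sigma> \<tau> (of_alg_tensor (a \<otimes>\<^sub>a b)) = of_alg_tensor (phase \<sigma> a \<otimes>\<^sub>a phase \<tau> b)"
    "norm (phase_twist \<sigma> \<tau> u) \<le> norm u"
    using * by simp_all
qed

text \<open>
  Acting by a phase function on the left shifts the left phase, and acting on the right shifts the
  right one. Two independent phases are kept, rather than \<open>\<theta>\<close> and \<open>- \<theta>\<close>, so that both actions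
  stay within the family.
\<close>

lemma lact_phase_twist: "phase \<rho> a \<bullet>\<^sub>l phase_twist \<sigma> \<tau> u = phase_twist (\<rho> + \<sigma>) \<tau> (a \<bullet>\<^sub>l u)"
  by (rule bounded_linear_eq_on_tensors [of "\<lambda>u. phase \<rho> a \<bullet>\<^sub>l phase_twist \<sigma> \<tau> u"])
    (simp_all add: bounded_linear_compose bounded_linear_phase_twist bounded_linear_lact
      phase_twist_tensor lact_tensor phase_mult)

lemma ract_phase_twist: "phase_twist \<sigma> \<tau> u \<bullet>\<^sub>r phase \<rho> a = phase_twist \<sigma> (\<tau> + \<rho>) (u \<bullet>\<^sub>r a)"
  by (rule bounded_linear_eq_on_tensors [of "\<lambda>u. phase_twist \<sigma> \<tau> u \<bullet>\<^sub>r phase \<rho> a"])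
    (simp_all add: bounded_linear_compose [OF bounded_linear_ract]
      bounded_linear_compose [OF bounded_linear_phase_twist] bounded_linear_phase_twist
      bounded_linear_ract phase_twist_tensor ract_tensor phase_mult)

lemma proj_prod_phase_twist: "proj_prod (phase_twist \<sigma> \<tau> u) = phase (\<sigma> + \<tau>) (proj_prod u)"
  by (rule bounded_linear_eq_on_tensors [of "\<lambda>u. proj_prod (phase_twist \<sigma> \<tau> u)"])
    (simp_all add: bounded_linear_compose [OF bounded_linear_proj_prod]
      bounded_linear_compose [OF bounded_linear_phase] bounded_linear_phase_twist
      bounded_linear_proj_prod phase_twist_tensor proj_prod_tensor phase_mult)

section \<open>Bounded approximate diagonals of continuous functions\<close>

theorem theorem2p1:
  assumes "compact (UNIV :: 'x :: t2_space set)"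
    and "has_bounded_approximate_diagonal TYPE('a :: complex_banach_algebra)"
  shows "has_bounded_approximate_diagonal TYPE('x \<Rightarrow>\<^sub>C 'a)"
proof -
  obtain K where K: "0 < K" "\<And>(S :: 'a set) e. finite S \<Longrightarrow> 0 < e \<Longrightarrow> \<exists>u. norm u \<le> K \<and>
      (\<forall>a\<in>S. norm (a \<bullet>\<^sub>l u - u \<bullet>\<^sub>r a) < e \<and> norm (proj_prod u * a - a) < e)"
    using has_bounded_approximate_diagonalD [OF assms(2)] by metis
  show ?thesis
  proof (rule has_bounded_approximate_diagonal_generators [OF span_phases_dense [OF assms(1)]])
    fix S :: "('x \<Rightarrow>\<^sub>C 'a) set" and e :: real
    assume "finite S" "S \<subseteq> range (case_prod phase)" and e: "0 < e"
    then obtain R where R: "finite R" "S = case_prod phase ` R"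
      by (meson finite_subset_image)
    obtain m where m: "norm m \<le> K"
      and central: "\<And>a. a \<in> snd ` R \<Longrightarrow> norm (a \<bullet>\<^sub>l m - m \<bullet>\<^sub>r a) < e / 2"
      and unit: "\<And>a. a \<in> snd ` R \<Longrightarrow> norm (proj_prod m * a - a) < e / 2"
      using K(2) [of "snd ` R" "e / 2"] R(1) e by auto
    \<comment> \<open>\<open>B\<close> bounds \<open>norm (a \<bullet>\<^sub>l m)\<close> for all \<open>a\<close> in question; the summand 1 keeps it positive.\<close>
    define B where "B = 1 + K * (\<Sum>a\<in>snd ` R. norm a)"
    have B: "norm a * K \<le> B" if "a \<in> snd ` R" for a
    proof -
      have "norm a \<le> (\<Sum>a\<in>snd ` R. norm a)"
        using R(1) by (intro member_le_sum [OF that]) auto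
      then show ?thesis using K(1) by (simp add: B_def mult.commute add_increasing)
    qed
    have "0 < B"
      using K(1) by (auto simp: B_def intro!: add_pos_nonneg mult_nonneg_nonneg sum_nonneg)
    obtain N where N: "4 * B / e < real N" using reals_Archimedean2 by blast
    moreover have "0 < 4 * B / e" using \<open>0 < B\<close> e by simp
    ultimately have "0 < N" by linarith
    have BN: "2 * B / real N < e / 2" using N e \<open>0 < N\<close> by (simp add: field_simps)
    obtain L :: "('x \<Rightarrow>\<^sub>C real) multiset" where L: "L \<noteq> {#}"
      and inv: "\<And>(P :: _ \<Rightarrow> ('x \<Rightarrow>\<^sub>C 'a) \<otimes>\<^sub>\<pi> ('x \<Rightarrow>\<^sub>C 'a)) C \<rho>.
        \<rho> \<in> fst ` R \<Longrightarrow> (\<And>\<theta>. norm (P \<theta>) \<le> C) \<Longrightarrow>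
        norm (mset_avg L (\<lambda>\<theta>. P (\<rho> + \<theta>)) - mset_avg L P) \<le> 2 * C / real N"
      using almost_invariant_multiset [of "fst ` R" N] R(1) \<open>0 < N\<close> by blast
    define d where "d = mset_avg L (\<lambda>\<theta>. phase_twist \<theta> (- \<theta>) m)"
    have "norm d \<le> K"
      unfolding d_def by (intro norm_mset_avg_le order_trans [OF norm_phase_twist_le m])
    moreover have "norm (F \<bullet>\<^sub>l d - d \<bullet>\<^sub>r F) < e \<and> norm (proj_prod d * F - F) < e" if "F \<in> S" for F
    proof -
      obtain \<rho> a where F: "F = phase \<rho> a" and Ra: "\<rho> \<in> fst ` R" "a \<in> snd ` R"
        using \<open>F \<in> S\<close> R(2) by force
      \<comment> \<open>The right phase contains \<open>\<rho>\<close> so that it is \<open>- \<theta>\<close> in \<open>P (\<rho> + \<theta>)\<close>, as \<open>F \<bullet>\<^sub>l d\<close> needs.\<close>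
      define P where "P \<theta> = phase_twist \<theta> (\<rho> - \<theta>) (a \<bullet>\<^sub>l m)" for \<theta>
      have P_le: "norm (P \<theta>) \<le> B" for \<theta>
      proof -
        have "norm (P \<theta>) \<le> norm a * norm m"
          unfolding P_def by (intro order_trans [OF norm_phase_twist_le] norm_lact_le)
        also have "\<dots> \<le> norm a * K" using m by (rule mult_left_mono) simp
        finally show ?thesis using B [OF Ra(2)] by simp
      qed
      have "F \<bullet>\<^sub>l d = mset_avg L (\<lambda>\<theta>. P (\<rho> + \<theta>))"
        by (simp add: d_def F P_def lact_phase_twist
            linear_mset_avg [OF bounded_linear.linear [OF bounded_linear_lact]])
      moreover have "d \<bullet>\<^sub>r F = mset_avg L (\<lambda>\<theta>. phase_twist \<theta> (\<rho> - \<theta>) (m \<bullet>\<^sub>r a))"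
        by (simp add: d_def F ract_phase_twist
            linear_mset_avg [OF bounded_linear.linear [OF bounded_linear_ract]])
      moreover have "mset_avg L P - mset_avg L (\<lambda>\<theta>. phase_twist \<theta> (\<rho> - \<theta>) (m \<bullet>\<^sub>r a)) =
          mset_avg L (\<lambda>\<theta>. phase_twist \<theta> (\<rho> - \<theta>) (a \<bullet>\<^sub>l m - m \<bullet>\<^sub>r a))"
        by (simp add: mset_avg_diff P_def
            linear_diff [OF bounded_linear.linear [OF bounded_linear_phase_twist]])
      ultimately have "norm (F \<bullet>\<^sub>l d - d \<bullet>\<^sub>r F) =
          norm ((mset_avg L (\<lambda>\<theta>. P (\<rho> + \<theta>)) - mset_avg L P) +
            mset_avg L (\<lambda>\<theta>. phase_twist \<theta> (\<rho> - \<theta>) (a \<bullet>\<^sub>l m - m \<bullet>\<^sub>r a)))"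
        by (simp add: algebra_simps)
      also have "\<dots> \<le> 2 * B / real N + norm (a \<bullet>\<^sub>l m - m \<bullet>\<^sub>r a)"
        by (intro order_trans [OF norm_triangle_ineq] add_mono inv [of \<rho> P B, OF Ra(1) P_le]
            norm_mset_avg_le norm_phase_twist_le)
      also have "\<dots> < e"
        using BN central [OF Ra(2)] by linarith
      finally have "norm (F \<bullet>\<^sub>l d - d \<bullet>\<^sub>r F) < e" .
      moreover have "proj_prod d = phase 0 (proj_prod m)"
        by (simp add: d_def proj_prod_phase_twist mset_avg_const [OF L]
            linear_mset_avg [OF bounded_linear.linear [OF bounded_linear_proj_prod]])
      then have "proj_prod d * F - F = phase \<rho> (proj_prod m * a - a)"
        by (simp add: F phase_mult phase_diff)
      then have "norm (proj_prod d * F - F) < e"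
        using norm_phase_le [of \<rho> "proj_prod m * a - a"] unit [OF Ra(2)] e by simp
      ultimately show ?thesis by blast
    qed
    ultimately show "\<exists>u. norm u \<le> K \<and>
        (\<forall>F\<in>S. norm (F \<bullet>\<^sub>l u - u \<bullet>\<^sub>r F) < e \<and> norm (proj_prod u * F - F) < e)"
      by blast
  qed
qed

end
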